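(* Let $0<s_-<s_+\le1$, and let $\eta$ be any Borel probability measure supported on $[s_-,s_+]$. Define the probability measure $$\nu_\eta=\int_{s_-}^{s_+}\mu_{\psi(s)}\,d\eta(s)$$ on $[0,1]$. Then $\nu_\eta$ is atomless, has full support $[0,1]$, and satisfies $$\nu_\eta(Q)\le(1-\psi(s_-))^n\qquad(Q\in\mathcal D_n).$$ Its dyadic local dimension $s(x)=\lim_{n\to\infty}\frac{-\log\nu_\eta(Q_n(x))}{n}$ exists for $\nu_\eta$-almost every $x$ and has the prescribed law $$s_*\nu_\eta=\eta.$$ In particular, $$h(\nu_\eta)=\int_{s_-}^{s_+}s\,d\eta(s),\qquad D_0(\nu_\eta)=\Bigl(\int_{s_-}^{s_+}s^{-1}\,d\eta(s)\Bigr)^{-1}.$$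
   Context: $\log$ is the logarithm to base 2 and $\ln$ the natural logarithm. $\mathcal D_n$ is the partition of $[0,1]$ into the $2^n$ half-open dyadic intervals of length $2^{-n}$ (the point $1$ being assigned to the last interval), and $Q_n(x)$ is the interval of $\mathcal D_n$ containing $x$. For $p\in(0,1)$, $\mu_p$ is the law on $[0,1]$ of $\sum_{j\ge1}\omega_j2^{-j}$, where the digits $\omega_j\in\{0,1\}$ are independent with $\mathbb P(\omega_j=1)=p$. $h_2(p)=-p\log p-(1-p)\log(1-p)$ (with $0\log0=0$), and $\psi:[0,1]\to[0,1/2]$ is the inverse of the continuous strictly increasing function $h_2|_{[0,1/2]}$. The integral defining $\nu_\eta$ means $\nu_\eta(E)=\int\mu_{\psi(s)}(E)\,d\eta(s)$ for Borel $E$. For a Borel probability measure $\nu$ on $[0,1]$: $h(\nu)=\lim_{k\to\infty}-\frac1k\sum_{Q\in\mathcal D_k}\nu(Q)\log\nu(Q)$ when the limit exists, and $D_0(\nu)=\lim_{N\to\infty}\frac{\log N}{-\log\mathfrak e_{N,0}(\nu)}$ when the limit exists, where $\mathfrak e_{N,0}(\nu)=\inf_{1\le\#A\le N}\exp\bigl(\int\ln d(x,A)\,d\nu(x)\bigr)$, infimum over non-empty finite $A\subset\mathbb{R}$, $d(x,A)=\inf_{y\in A}|x-y|$. The displayed formulas include the existence of both limits. *)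

theory Defs
  imports "HOL-Probability.Probability"
begin

definition dyadic_interval :: "nat \<Rightarrow> nat \<Rightarrow> real set" where
  "dyadic_interval n k =
     (if k = 2 ^ n - 1 then {real k / 2 ^ n..1}
      else {real k / 2 ^ n..<(real k + 1) / 2 ^ n})"

definition dyadic_partition :: "nat \<Rightarrow> real set set" where
  "dyadic_partition n = dyadic_interval n ` {..<2 ^ n}"

(* Meaningful for x in [0,1] only. *)
definition dyadic_cell :: "nat \<Rightarrow> real \<Rightarrow> real set" where
  "dyadic_cell n x = (THE Q. Q \<in> dyadic_partition n \<and> x \<in> Q)"

(* Measures on [0,1] are represented as measures on the Borel sets of the real line
   giving full mass to [0,1].  The coordinate w j (j = 0, 1, ...) is the (j+1)-st binary digit. *)
definition digit_law :: "real \<Rightarrow> real measure" where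
  "digit_law p =
     distr (\<Pi>\<^sub>M j\<in>(UNIV :: nat set). measure_pmf (bernoulli_pmf p)) borel
       (\<lambda>w. \<Sum>j. of_bool (w j) / 2 ^ Suc j)"

(* The convention 0 log 0 = 0 holds automatically, since 0 * x = 0. *)
definition binary_entropy :: "real \<Rightarrow> real" where
  "binary_entropy p = - p * log 2 p - (1 - p) * log 2 (1 - p)"

(* Meaningful on [0,1] only. *)
definition inv_binary_entropy :: "real \<Rightarrow> real" where
  "inv_binary_entropy = the_inv_into {0..1/2} binary_entropy"

(* measure_of yields the null measure if its set function fails to be countably additive;
   that this does not happen is part of the claim that the mixture is a probability measure. *)
definition digit_mixture :: "real measure \<Rightarrow> real measure" where
  "digit_mixture \<eta> =
     measure_of UNIV (sets borel)
       (\<lambda>E. \<integral>\<^sup>+ s. emeasure (digit_law (inv_binary_entropy s)) E \<partial>\<eta>)"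

definition measure_support :: "real measure \<Rightarrow> real set" where
  "measure_support \<nu> = {x. \<forall>U. open U \<longrightarrow> x \<in> U \<longrightarrow> emeasure \<nu> U > 0}"

definition local_dim_seq :: "real measure \<Rightarrow> real \<Rightarrow> nat \<Rightarrow> real" where
  "local_dim_seq \<nu> x n = - log 2 (measure \<nu> (dyadic_cell n x)) / real n"

(* Takes a fixed unspecified value at the points x where the limit does not exist. *)
definition local_dim :: "real measure \<Rightarrow> real \<Rightarrow> real" where
  "local_dim \<nu> x = lim (local_dim_seq \<nu> x)"

definition has_entropy_dim :: "real measure \<Rightarrow> real \<Rightarrow> bool" where
  "has_entropy_dim \<nu> h \<longleftrightarrow>
     (\<lambda>k. - (1 / real k) * (\<Sum>Q\<in>dyadic_partition k. measure \<nu> Q * log 2 (measure \<nu> Q)))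
       \<longlonglongrightarrow> h"

(* The exponential of the integral of ln d(x,A).  For a probability measure on [0,1] and a finite
   non-empty A, the function ln d(x,A) is bounded above on [0,1], so its integral exists in
   [-infinity, infinity).  It is -infinity, with exponential 0, if d(x,A) = 0 on a set of positive
   measure (where the real-valued ln would give ln 0 = 0) or if ln d(x,A) is not integrable. *)
definition geom_mean_dist :: "real measure \<Rightarrow> real set \<Rightarrow> real" where
  "geom_mean_dist \<nu> A =
     (if (AE x in \<nu>. infdist x A > 0) \<and> integrable \<nu> (\<lambda>x. ln (infdist x A))
      then exp (\<integral>x. ln (infdist x A) \<partial>\<nu>) else 0)"

definition quant_error0 :: "nat \<Rightarrow> real measure \<Rightarrow> real" where
  "quant_error0 N \<nu> =
     (INF A\<in>{A. finite A \<and> 1 \<le> card A \<and> card A \<le> N}. geom_mean_dist \<nu> A)"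

definition has_quant_dim0 :: "real measure \<Rightarrow> real \<Rightarrow> bool" where
  "has_quant_dim0 \<nu> D \<longleftrightarrow>
     (\<lambda>N. log 2 (real N) / (- log 2 (quant_error0 N \<nu>))) \<longlonglongrightarrow> D"

end

theory Submission
  imports Defs "HOL-Real_Asymp.Real_Asymp"
begin

text \<open>
  Under $\mu_q$ the digit frequencies converge to $q$ (Hoeffding and Borel--Cantelli).  The mass
  of the dyadic cell $Q_n(x)$ is the average of $2^{n(f_n \log p + (1-f_n)\log(1-p))}$ over the
  law of the parameter $p$, where $f_n$ is the frequency of ones among the first $n$ digits of $x$.
  As $f_n \to q$, Gibbs' inequality bounds this from above by $2^{-n(h_2(q) - o(1))}$, and the
  parameters close to $q$, which have positive mass for almost every $q$, bound it from below.
  So the local dimension is $h_2(q)$, that is $s$, at $\mu_{\psi(s)}$-almost every point.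

  For the geometric mean error let $L_\tau(x)$ be the number of levels $n$ with
  $\nu(Q_n(x)) \ge \tau$; then $L_\tau(x)/\log(1/\tau) \to 1/s(x)$ boundedly.  A set $A$ with one
  point in each cell of mass at least $\tau$ has $O(\tau^{-1}\log(1/\tau))$ elements and satisfies
  $-\log d(x,A) \ge L_\tau(x) - 1$.  Conversely the $2^{-n}$-neighbourhood of any $N$ points is
  covered by at most $3N$ cells of level $n$, whence
  $\int -\log d(x,A)\,d\nu \le \int L_\tau\,d\nu + 3N\sum_n \min(\tau,\rho^n)$.  Choosing $\tau$
  equal to $1/N$ up to logarithmic factors makes both bounds asymptotic to
  $\log N \int 1/s\,d\nu$.
\<close>

section \<open>Dyadic cells\<close>

text \<open>The local dimension varies from point to point, so no single level suits all of [0,1]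
  when N points are placed. A single mass threshold \<tau> does: a cell of mass about 1/N deserves a
  point wherever it lies and however deep it is. Counting levels replaces the logarithm of a
  distance: if d(x,A) < 1, then -log d(x,A) is, up to 1, the number of n with d(x,A) < 2^(-n). A
  point of local dimension s has about log(1/\<tau>) / s heavy levels, which is why the mean of 1/s
  appears and not that of s. The uniform decay \<rho>^n of cell masses, available because s_- > 0,
  confines heavy cells to O(log(1/\<tau>)) levels and lets the limit of L_\<tau> / log(1/\<tau>)
  pass under the integral. The error estimates are therefore made for any measure with such decay,
  positive cells and convergent local exponents. The mixture is handled through the law \<pi> of the
  digit probability p = \<psi>(s), with c = \<psi>(s_-) and \<rho> = 1 - c. The bound c <= p also
  bounds log p, so that replacing f_n by q costs an error uniform in p.\<close>

definition dyadic_index :: "nat \<Rightarrow> real \<Rightarrow> nat" where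
  "dyadic_index n x = (if x = 1 then 2 ^ n - 1 else nat \<lfloor>x * 2 ^ n\<rfloor>)"

lemma dyadic_index_less:
  assumes "x \<in> {0..1}" shows "dyadic_index n x < 2 ^ n"
proof (cases "x = 1")
  case False
  then have "x * 2 ^ n < 1 * 2 ^ n" using assms by (intro mult_strict_right_mono) auto
  then have "\<lfloor>x * 2 ^ n\<rfloor> < 2 ^ n" by (simp add: floor_less_iff)
  moreover have "0 \<le> \<lfloor>x * 2 ^ n\<rfloor>" using assms by simp
  ultimately show ?thesis using False by (simp add: dyadic_index_def nat_less_iff)
qed (simp add: dyadic_index_def)

lemma nat_floor_eq_iff:
  fixes y :: real
  assumes "0 \<le> y" shows "nat \<lfloor>y\<rfloor> = k \<longleftrightarrow> real k \<le> y \<and> y < real k + 1"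
proof -
  have "nat \<lfloor>y\<rfloor> = k \<longleftrightarrow> \<lfloor>y\<rfloor> = int k" using assms by auto
  then show ?thesis by (simp add: floor_eq_iff)
qed

lemma mem_dyadic_interval_iff:
  assumes "k < 2 ^ n"
  shows "x \<in> dyadic_interval n k \<longleftrightarrow> x \<in> {0..1} \<and> dyadic_index n x = k"
proof -
  have k1: "real k + 1 \<le> 2 ^ n"
    using of_nat_mono[OF Suc_leI[OF assms], where 'a = real] by (simp add: add.commute)
  show ?thesis
  proof (cases "k = 2 ^ n - 1")
    case True
    then have rk: "real k = 2 ^ n - 1" by (simp add: of_nat_diff)
    have "x \<in> dyadic_interval n k \<longleftrightarrow> 2 ^ n - 1 \<le> x * 2 ^ n \<and> x \<le> 1"
      using True rk by (simp add: dyadic_interval_def divide_le_eq)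
    also have "\<dots> \<longleftrightarrow> x \<in> {0..1} \<and> dyadic_index n x = k"
    proof (cases "x = 1")
      case False
      have "nat \<lfloor>x * 2 ^ n\<rfloor> = k \<longleftrightarrow> real k \<le> x * 2 ^ n \<and> x * 2 ^ n < real k + 1" if "0 \<le> x"
        using that by (simp add: nat_floor_eq_iff)
      moreover have "x * 2 ^ n < 2 ^ n \<longleftrightarrow> x < 1" by simp
      moreover have "0 \<le> x" if "2 ^ n - 1 \<le> x * 2 ^ n"
      proof -
        have "(0::real) \<le> 2 ^ n - 1" by simp
        then have "0 \<le> x * 2 ^ n" using that by linarith
        then show ?thesis by (simp add: zero_le_mult_iff power_le_zero_eq)
      qed
      ultimately show ?thesis using False rk by (auto simp: dyadic_index_def)
    qed (simp add: True dyadic_index_def)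
    finally show ?thesis .
  next
    case False
    have fl: "nat \<lfloor>x * 2 ^ n\<rfloor> = k \<longleftrightarrow> real k \<le> x * 2 ^ n \<and> x * 2 ^ n < real k + 1" if "0 \<le> x"
      using that by (simp add: nat_floor_eq_iff)
    have eq: "x \<in> dyadic_interval n k \<longleftrightarrow> real k \<le> x * 2 ^ n \<and> x * 2 ^ n < real k + 1"
      using False by (simp add: dyadic_interval_def divide_le_eq less_divide_eq)
    show ?thesis
    proof (cases "x = 1")
      case True
      then show ?thesis using eq k1 False by (simp add: dyadic_index_def)
    next
      case x1: False
      have "x \<in> {0..1}" if "real k \<le> x * 2 ^ n" "x * 2 ^ n < real k + 1"
      proof -
        have "0 \<le> x * 2 ^ n" using that(1) by linarith
        then have "0 \<le> x" by (simp add: zero_le_mult_iff power_le_zero_eq)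
        moreover have "x * 2 ^ n < 1 * 2 ^ n" using that k1 by linarith
        then have "x < 1" by simp
        ultimately show ?thesis by simp
      qed
      then show ?thesis using eq fl x1 by (auto simp: dyadic_index_def)
    qed
  qed
qed

lemma inj_on_dyadic_interval: "inj_on (dyadic_interval n) {..<2 ^ n}"
proof (rule inj_onI)
  fix i j assume ij: "i \<in> {..<2 ^ n}" "j \<in> {..<2 ^ n}" "dyadic_interval n i = dyadic_interval n j"
  moreover have "real i / 2 ^ n \<in> dyadic_interval n i"
    using ij(1) of_nat_mono[of i "2 ^ n", where 'a = real] by (simp add: dyadic_interval_def divide_simps)
  ultimately show "i = j" using mem_dyadic_interval_iff by (metis lessThan_iff)
qed

lemma dyadic_cell_eq:
  assumes "x \<in> {0..1}" shows "dyadic_cell n x = dyadic_interval n (dyadic_index n x)"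
  unfolding dyadic_cell_def
proof (rule the_equality)
  show "dyadic_interval n (dyadic_index n x) \<in> dyadic_partition n \<and> x \<in> dyadic_interval n (dyadic_index n x)"
    using dyadic_index_less[OF assms] assms mem_dyadic_interval_iff by (auto simp: dyadic_partition_def)
qed (use mem_dyadic_interval_iff in \<open>auto simp: dyadic_partition_def\<close>)

lemma dyadic_cell_in_partition: "x \<in> {0..1} \<Longrightarrow> dyadic_cell n x \<in> dyadic_partition n"
  using dyadic_index_less by (auto simp: dyadic_cell_eq dyadic_partition_def)

lemma mem_dyadic_cell: "x \<in> {0..1} \<Longrightarrow> x \<in> dyadic_cell n x"
  using dyadic_index_less by (simp add: dyadic_cell_eq mem_dyadic_interval_iff)

lemma dyadic_cell_unique:
  "Q \<in> dyadic_partition n \<Longrightarrow> x \<in> Q \<Longrightarrow> x \<in> {0..1} \<and> dyadic_cell n x = Q"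
  by (auto simp: dyadic_partition_def mem_dyadic_interval_iff dyadic_cell_eq)

text \<open>No cell contains such a point, so the description has the same unspecified value at all
  of them. Functions of the cell are then constant off the unit interval, hence measurable on the
  whole line.\<close>

lemma dyadic_cell_outside:
  assumes "x \<notin> {0..1}" shows "dyadic_cell n x = (THE Q. False)"
  unfolding dyadic_cell_def using assms dyadic_cell_unique by (metis (no_types, lifting))

lemma finite_dyadic_partition [simp]: "finite (dyadic_partition n)"
  by (simp add: dyadic_partition_def)

lemma dyadic_partition_borel [measurable]: "Q \<in> dyadic_partition n \<Longrightarrow> Q \<in> sets borel"
  by (auto simp: dyadic_partition_def dyadic_interval_def)

lemma dyadic_partition_0: "dyadic_partition 0 = {{0..1}}"
  by (auto simp: dyadic_partition_def dyadic_interval_def)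

lemma dyadic_partition_dist_le:
  assumes "Q \<in> dyadic_partition n" "x \<in> Q" "y \<in> Q" shows "\<bar>x - y\<bar> \<le> 1 / 2 ^ n"
proof -
  obtain k where k: "k < 2 ^ n" "Q = dyadic_interval n k" using assms by (auto simp: dyadic_partition_def)
  have "(1::real) = real (2 ^ n - 1) / 2 ^ n + 1 / 2 ^ n" by (simp add: of_nat_diff diff_divide_distrib)
  then have "Q \<subseteq> {real k / 2 ^ n..real k / 2 ^ n + 1 / 2 ^ n}"
    unfolding k dyadic_interval_def by (auto simp: add_divide_distrib)
  then have "x \<in> {real k / 2 ^ n..real k / 2 ^ n + 1 / 2 ^ n}" "y \<in> {real k / 2 ^ n..real k / 2 ^ n + 1 / 2 ^ n}"
    using assms by blast+
  then show ?thesis by auto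
qed

lemma sum_indicator_dyadic:
  fixes g :: "real set \<Rightarrow> real"
  assumes "x \<in> {0..1}"
  shows "(\<Sum>Q\<in>dyadic_partition n. indicator Q x * g Q) = g (dyadic_cell n x)"
proof -
  have "(\<Sum>Q\<in>dyadic_partition n. indicator Q x * g Q)
      = (\<Sum>Q\<in>dyadic_partition n. if Q = dyadic_cell n x then g Q else 0)"
  proof (intro sum.cong refl)
    fix Q assume "Q \<in> dyadic_partition n"
    then have "x \<in> Q \<longleftrightarrow> Q = dyadic_cell n x"
      using dyadic_cell_unique mem_dyadic_cell[OF assms] by blast
    then show "indicator Q x * g Q = (if Q = dyadic_cell n x then g Q else 0)"
      by (simp add: indicator_def)
  qed
  then show ?thesis using dyadic_cell_in_partition[OF assms] by simp
qed

text \<open>The cell takes finitely many values, each on a Borel set, so composing it with an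
  arbitrary \<open>g\<close> yields a simple function.\<close>

lemma borel_measurable_dyadic_cell [measurable]:
  fixes g :: "real set \<Rightarrow> real"
  shows "(\<lambda>x. g (dyadic_cell n x)) \<in> borel_measurable borel"
proof -
  have "(\<lambda>x. g (dyadic_cell n x)) = (\<lambda>x. if x \<in> {0..1}
      then \<Sum>Q\<in>dyadic_partition n. indicator Q x * g Q else g (THE Q. False))"
  proof
    fix x :: real
    show "g (dyadic_cell n x) = (if x \<in> {0..1}
        then \<Sum>Q\<in>dyadic_partition n. indicator Q x * g Q else g (THE Q. False))"
      using sum_indicator_dyadic[of x g n] dyadic_cell_outside[of x n]
      by (cases "x \<in> {0..1}") (simp_all only: if_True if_False simp_thms)
  qed
  also have "\<dots> \<in> borel_measurable borel"
    by measurable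
  finally show ?thesis .
qed

lemma borel_measurable_local_dim_seq [measurable]:
  "(\<lambda>x. local_dim_seq \<nu> x n) \<in> borel_measurable borel"
  unfolding local_dim_seq_def using borel_measurable_dyadic_cell[of "\<lambda>Q. - log 2 (measure \<nu> Q) / real n" n] .

lemma borel_measurable_local_dim [measurable]: "local_dim \<nu> \<in> borel_measurable borel"
  unfolding local_dim_def by (rule borel_measurable_lim_metric) measurable

text \<open>Two reals at distance less than 1 have floors differing by at most 1. The three possible
  indices are the origin of the factor 3 in the covering bound. At 1 the index is not the floor,
  hence the half-open range of x.\<close>

lemma dyadic_index_near:
  assumes "x \<in> {0..<1}" "\<bar>x - a\<bar> < 1 / 2 ^ n"
  shows "int (dyadic_index n x) \<in> {\<lfloor>a * 2 ^ n\<rfloor> - 1..\<lfloor>a * 2 ^ n\<rfloor> + 1}"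
proof -
  have "\<bar>x * 2 ^ n - a * 2 ^ n\<bar> = \<bar>x - a\<bar> * 2 ^ n"
    by (simp add: abs_mult flip: left_diff_distrib)
  also have "\<dots> < 1" using assms(2) by (simp add: less_divide_eq)
  finally have "\<bar>x * 2 ^ n - a * 2 ^ n\<bar> < 1" .
  moreover have "int (dyadic_index n x) = \<lfloor>x * 2 ^ n\<rfloor>" using assms by (simp add: dyadic_index_def)
  ultimately show ?thesis by (simp, linarith)
qed

section \<open>Counting the levels of heavy cells\<close>

text \<open>The set contains 0, so it has floor(r) + 1 elements.\<close>

lemma card_nat_le_real:
  assumes "0 \<le> r"
  shows "finite {n::nat. real n \<le> r}" "real (card {n::nat. real n \<le> r}) \<le> r + 1"
    "r \<le> real (card {n::nat. real n \<le> r})"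
proof -
  have eq: "{n::nat. real n \<le> r} = {..nat \<lfloor>r\<rfloor>}"
    using assms by (auto simp: le_nat_floor) (simp add: le_floor_iff nat_le_iff le_nat_iff)
  have "real (nat \<lfloor>r\<rfloor>) = real_of_int \<lfloor>r\<rfloor>" using assms by simp
  then have "real (nat \<lfloor>r\<rfloor>) \<le> r" "r \<le> real (nat \<lfloor>r\<rfloor>) + 1"
    by linarith+
  then show "finite {n::nat. real n \<le> r}" "real (card {n::nat. real n \<le> r}) \<le> r + 1"
    "r \<le> real (card {n::nat. real n \<le> r})"
    unfolding eq card_atMost of_nat_Suc by - (rule finite_atMost, linarith+)
qed

text \<open>Since a n is asymptotic to s * n, the inequality a n \<le> T amounts to n being at most
  about T / s. The sequence may oscillate, so the two sets are compared by inclusion up to an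
  initial segment.\<close>

lemma tendsto_card_sublevel:
  fixes a :: "nat \<Rightarrow> real"
  assumes lim: "(\<lambda>n. a n / real n) \<longlonglongrightarrow> s" and s: "0 < s"
  shows "((\<lambda>T. real (card {n. a n \<le> T}) / T) \<longlongrightarrow> 1 / s) at_top"
proof -
  \<comment> \<open>The constant C = n0 + 1 absorbs the indices below n0, where the linear bounds on
    a n may fail, and the counted index 0. It does not depend on T and disappears after division by
    T.\<close>
  have bounds: "\<exists>C. \<forall>T>0. T / (s + e) - C \<le> real (card {n. a n \<le> T})
      \<and> real (card {n. a n \<le> T}) \<le> T / (s - e) + C" if e: "0 < e" "e < s" for e
  proof -
    have "\<forall>\<^sub>F n in sequentially. s - e < a n / real n" "\<forall>\<^sub>F n in sequentially. a n / real n < s + e"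
      using order_tendstoD[OF lim] e by simp_all
    then have "\<forall>\<^sub>F n in sequentially. (s - e) * n \<le> a n \<and> a n \<le> (s + e) * n"
      using eventually_gt_at_top[of 0]
      by eventually_elim (auto simp: divide_less_eq less_divide_eq)
    then obtain n0 where n0: "\<And>n. n \<ge> n0 \<Longrightarrow> (s - e) * n \<le> a n \<and> a n \<le> (s + e) * n"
      unfolding eventually_sequentially by blast
    have "T / (s + e) - (n0 + 1) \<le> real (card {n. a n \<le> T})
      \<and> real (card {n. a n \<le> T}) \<le> T / (s - e) + (n0 + 1)" if T: "T > 0" for T
    proof -
      have sub: "{n. a n \<le> T} \<subseteq> {..<n0} \<union> {n. real n \<le> T / (s - e)}"
      proof
        fix n assume "n \<in> {n. a n \<le> T}"
        then have "n < n0 \<or> (s - e) * n \<le> T" using n0[of n] by fastforce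
        then show "n \<in> {..<n0} \<union> {n. real n \<le> T / (s - e)}"
          using e by (auto simp: pos_le_divide_eq mult.commute)
      qed
      have sub2: "{n. real n \<le> T / (s + e)} \<subseteq> {..<n0} \<union> {n. a n \<le> T}"
      proof
        fix n assume "n \<in> {n. real n \<le> T / (s + e)}"
        then have "(s + e) * n \<le> T" using e s by (simp add: pos_le_divide_eq mult.commute)
        then show "n \<in> {..<n0} \<union> {n. a n \<le> T}" using n0[of n] by fastforce
      qed
      have fin: "finite {n. a n \<le> T}"
        using finite_subset[OF sub] card_nat_le_real(1)[of "T / (s - e)"] T e by simp
      have "card {n. a n \<le> T} \<le> n0 + card {n. real n \<le> T / (s - e)}"
        using card_mono[OF _ sub] card_Un_le[of "{..<n0}" "{n. real n \<le> T / (s - e)}"]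
          card_nat_le_real(1)[of "T / (s - e)"] T e by simp
      moreover have "card {n. real n \<le> T / (s + e)} \<le> n0 + card {n. a n \<le> T}"
        using card_mono[OF _ sub2] card_Un_le[of "{..<n0}" "{n. a n \<le> T}"] fin by simp
      ultimately show ?thesis
        using card_nat_le_real(2)[of "T / (s - e)"] card_nat_le_real(3)[of "T / (s + e)"] T e s by auto
    qed
    then show ?thesis by blast
  qed
  show ?thesis
  proof (rule order_tendstoI)
    fix u assume u: "u < 1 / s"
    have "((\<lambda>e. 1 / (s + e)) \<longlongrightarrow> 1 / (s + 0)) (at_right 0)"
      by (intro tendsto_intros) (use s in auto)
    from order_tendstoD(1)[OF this, of u] u have "\<forall>\<^sub>F e in at_right 0. u < 1 / (s + e)" by simp
    moreover have "\<forall>\<^sub>F e in at_right 0. 0 < e \<and> e < s"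
      using s by (auto simp: eventually_at_right_field)
    ultimately have "\<forall>\<^sub>F e in at_right 0. u < 1 / (s + e) \<and> 0 < e \<and> e < s" by eventually_elim simp
    then obtain e where e: "u < 1 / (s + e)" "0 < e" "e < s"
      using eventually_happens'[OF trivial_limit_at_right_real] by blast
    then obtain C where C: "\<And>T. T > 0 \<Longrightarrow> T / (s + e) - C \<le> real (card {n. a n \<le> T})" using bounds by blast
    have "((\<lambda>T. 1 / (s + e) - C / T) \<longlongrightarrow> 1 / (s + e) - 0) at_top"
      by (intro tendsto_intros real_tendsto_divide_at_top[OF tendsto_const] filterlim_ident)
    from order_tendstoD(1)[OF this, of u] have "\<forall>\<^sub>F T in at_top. u < 1 / (s + e) - C / T" using e by simp
    then show "\<forall>\<^sub>F T in at_top. u < real (card {n. a n \<le> T}) / T"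
      using eventually_gt_at_top[of 0]
    proof eventually_elim
      case (elim T)
      have "1 / (s + e) - C / T = (T / (s + e) - C) / T" using elim e s by (simp add: diff_divide_distrib)
      also have "\<dots> \<le> real (card {n. a n \<le> T}) / T" using C elim by (intro divide_right_mono) auto
      finally show ?case using elim by simp
    qed
  next
    fix u assume u: "u > 1 / s"
    have "((\<lambda>e. 1 / (s - e)) \<longlongrightarrow> 1 / (s - 0)) (at_right 0)"
      by (intro tendsto_intros) (use s in auto)
    from order_tendstoD(2)[OF this, of u] u have "\<forall>\<^sub>F e in at_right 0. u > 1 / (s - e)" by simp
    moreover have "\<forall>\<^sub>F e in at_right 0. 0 < e \<and> e < s"
      using s by (auto simp: eventually_at_right_field)
    ultimately have "\<forall>\<^sub>F e in at_right 0. u > 1 / (s - e) \<and> 0 < e \<and> e < s" by eventually_elim simp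
    then obtain e where e: "u > 1 / (s - e)" "0 < e" "e < s"
      using eventually_happens'[OF trivial_limit_at_right_real] by blast
    then obtain C where C: "\<And>T. T > 0 \<Longrightarrow> real (card {n. a n \<le> T}) \<le> T / (s - e) + C" using bounds by blast
    have "((\<lambda>T. 1 / (s - e) + C / T) \<longlongrightarrow> 1 / (s - e) + 0) at_top"
      by (intro tendsto_intros real_tendsto_divide_at_top[OF tendsto_const] filterlim_ident)
    from order_tendstoD(2)[OF this, of u] have "\<forall>\<^sub>F T in at_top. u > 1 / (s - e) + C / T" using e by simp
    then show "\<forall>\<^sub>F T in at_top. u > real (card {n. a n \<le> T}) / T"
      using eventually_gt_at_top[of 0]
    proof eventually_elim
      case (elim T)
      have "real (card {n. a n \<le> T}) / T \<le> (T / (s - e) + C) / T" using C elim by (intro divide_right_mono) auto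
      also have "\<dots> = 1 / (s - e) + C / T" using elim e s by (simp add: add_divide_distrib)
      finally show ?case using elim by simp
    qed
  qed
qed

text \<open>This collects what the error estimates use: geometric decay limits the depth of heavy
  cells, positive masses give every cell a genuine logarithm and a point, and convergence identifies
  the limit of the level count.\<close>

locale dyadic_regular_measure = prob_space \<nu> for \<nu> :: "real measure" +
  fixes \<rho> :: real
  assumes sets_eq [measurable_cong]: "sets \<nu> = sets borel"
    and emeasure_unit: "emeasure \<nu> {0..1} = 1"
    and rho: "0 < \<rho>" "\<rho> < 1"
    and cell_le: "\<And>n Q. Q \<in> dyadic_partition n \<Longrightarrow> measure \<nu> Q \<le> \<rho> ^ n"
    and cell_pos: "\<And>n Q. Q \<in> dyadic_partition n \<Longrightarrow> 0 < measure \<nu> Q"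
    and AE_convergent: "AE x in \<nu>. convergent (local_dim_seq \<nu> x)"
begin

text \<open>Cells of level n have mass at most 2 powr (- \<kappa> * n), so \<kappa> bounds the local
  dimension from below.\<close>

abbreviation "\<kappa> \<equiv> - log 2 \<rho>"

lemma kappa_pos: "0 < \<kappa>"
  using rho by (simp add: log_less_zero_cancel_iff)

lemma space_eq [simp]: "space \<nu> = UNIV"
  using sets_eq_imp_space_eq[OF sets_eq] by simp

lemma AE_unit: "AE x in \<nu>. x \<in> {0..1}"
  using emeasure_unit AE_in_set_eq_1[of "{0..1}"] by (simp add: emeasure_eq_measure)

lemma measure_singleton: "measure \<nu> {x} = 0"
proof (cases "x \<in> {0..1}")
  case True
  have "measure \<nu> {x} \<le> \<rho> ^ n" for n
  proof -
    have "measure \<nu> {x} \<le> measure \<nu> (dyadic_cell n x)"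
      using mem_dyadic_cell[OF True] dyadic_cell_in_partition[OF True] dyadic_partition_borel sets_eq
      by (intro finite_measure_mono) auto
    also have "\<dots> \<le> \<rho> ^ n" using cell_le dyadic_cell_in_partition[OF True] by simp
    finally show ?thesis .
  qed
  moreover have "(\<lambda>n. \<rho> ^ n) \<longlonglongrightarrow> 0" using rho by (intro LIMSEQ_power_zero) auto
  ultimately have "measure \<nu> {x} \<le> 0" by (intro LIMSEQ_le_const) auto
  then show ?thesis by (simp add: measure_le_0_iff)
next
  case False
  have "AE y in \<nu>. y \<notin> {x}" using AE_unit by eventually_elim (use False in auto)
  then show ?thesis using AE_iff_measurable[of "{x}" \<nu> "\<lambda>y. y \<notin> {x}"] by (simp add: measure_def sets_eq)
qed

lemma AE_not_in_finite:
  assumes "finite A" shows "AE x in \<nu>. x \<notin> A"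
proof -
  have "AE x in \<nu>. \<forall>a\<in>A. x \<noteq> a"
  proof (subst AE_ball_countable)
    show "\<forall>a\<in>A. AE x in \<nu>. x \<noteq> a"
    proof
      fix a
      show "AE x in \<nu>. x \<noteq> a"
        using measure_singleton[of a]
        by (subst AE_iff_measurable[of "{a}"]) (auto simp: emeasure_eq_measure sets_eq)
    qed
  qed (use assms countable_finite in auto)
  then show ?thesis by eventually_elim auto
qed

lemma sum_measure_cells: "(\<Sum>Q\<in>dyadic_partition n. measure \<nu> Q) = 1"
proof -
  have "(\<Sum>Q\<in>dyadic_partition n. measure \<nu> Q) = (\<integral>x. (\<Sum>Q\<in>dyadic_partition n. indicator Q x) \<partial>\<nu>)"
    by (subst Bochner_Integration.integral_sum)
      (auto intro!: integrable_real_indicator sum.cong simp: sets_eq dyadic_partition_borel emeasure_eq_measure)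
  also have "\<dots> = (\<integral>x. 1 \<partial>\<nu>)"
  proof (rule integral_cong_AE)
    show "AE x in \<nu>. (\<Sum>Q\<in>dyadic_partition n. indicator Q x) = (1::real)"
      using AE_unit by eventually_elim (use sum_indicator_dyadic[of _ "\<lambda>_. 1"] in simp)
  qed (auto intro!: borel_measurable_sum borel_measurable_indicator simp: sets_eq dyadic_partition_borel)
  finally show ?thesis using prob_space by simp
qed

lemma rho_power_ge:
  assumes "0 < \<tau>" "\<tau> \<le> \<rho> ^ n" shows "real n \<le> - log 2 \<tau> / \<kappa>"
proof -
  have "log 2 \<tau> \<le> log 2 (\<rho> ^ n)" using assms rho by (subst log_le_cancel_iff) auto
  also have "\<dots> = real n * log 2 \<rho>" using rho by (simp add: log_nat_power)
  finally have "real n * \<kappa> \<le> - log 2 \<tau>" by simp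
  then show ?thesis using kappa_pos by (simp add: le_divide_eq)
qed

lemma big_levels_subset:
  assumes "x \<in> {0..1}" "0 < \<tau>"
  shows "{n. \<tau> \<le> measure \<nu> (dyadic_cell n x)} \<subseteq> {n. real n \<le> - log 2 \<tau> / \<kappa>}"
proof
  fix n assume "n \<in> {n. \<tau> \<le> measure \<nu> (dyadic_cell n x)}"
  then have "\<tau> \<le> \<rho> ^ n" using cell_le[OF dyadic_cell_in_partition[OF assms(1)]] by (force intro: order_trans)
  then show "n \<in> {n. real n \<le> - log 2 \<tau> / \<kappa>}" using rho_power_ge assms by blast
qed

text \<open>Meaningful for \<open>x\<close> in \<open>{0..1}\<close> and \<open>0 < \<tau> \<le> 1\<close>, where the set is finite.\<close>

definition cell_count :: "real \<Rightarrow> real \<Rightarrow> real" where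
  "cell_count \<tau> x = real (card {n. \<tau> \<le> measure \<nu> (dyadic_cell n x)})"

lemma finite_big_levels:
  assumes "x \<in> {0..1}" "0 < \<tau>" "\<tau> \<le> 1"
  shows "finite {n. \<tau> \<le> measure \<nu> (dyadic_cell n x)}"
  using big_levels_subset[OF assms(1,2)] card_nat_le_real(1)[of "- log 2 \<tau> / \<kappa>"] kappa_pos assms
  by (meson divide_nonneg_pos finite_subset log_le_zero_cancel_iff neg_0_le_iff_le one_less_numeral_iff semiring_norm(76))

lemma cell_count_le:
  assumes "x \<in> {0..1}" "0 < \<tau>" "\<tau> \<le> 1"
  shows "cell_count \<tau> x \<le> - log 2 \<tau> / \<kappa> + 1"
proof -
  have nn: "0 \<le> - log 2 \<tau> / \<kappa>" using kappa_pos assms by (intro divide_nonneg_pos) auto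
  have "card {n. \<tau> \<le> measure \<nu> (dyadic_cell n x)} \<le> card {n. real n \<le> - log 2 \<tau> / \<kappa>}"
    by (rule card_mono[OF card_nat_le_real(1)[OF nn] big_levels_subset[OF assms(1,2)]])
  then show ?thesis using card_nat_le_real(2)[OF nn] by (simp add: cell_count_def)
qed

text \<open>The positive lower bound makes 1 / \<open>local_dim\<close> bounded, hence
  integrable.\<close>

lemma AE_local_dim:
  "AE x in \<nu>. (local_dim_seq \<nu> x \<longlonglongrightarrow> local_dim \<nu> x) \<and> \<kappa> \<le> local_dim \<nu> x"
  using AE_unit AE_convergent
proof eventually_elim
  case (elim x)
  then have lim: "local_dim_seq \<nu> x \<longlonglongrightarrow> local_dim \<nu> x"
    by (simp add: local_dim_def convergent_LIMSEQ_iff)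
  \<comment> \<open>For n = 0 division by zero gives the value 0, which is below \<kappa>.\<close>
  have "\<kappa> \<le> local_dim_seq \<nu> x n" if "n \<ge> 1" for n
  proof -
    have Q: "dyadic_cell n x \<in> dyadic_partition n" by (rule dyadic_cell_in_partition[OF elim(1)])
    have "log 2 (measure \<nu> (dyadic_cell n x)) \<le> log 2 (\<rho> ^ n)"
      using cell_le[OF Q] cell_pos[OF Q] rho by (subst log_le_cancel_iff) auto
    then have "real n * \<kappa> \<le> - log 2 (measure \<nu> (dyadic_cell n x))" using rho by (simp add: log_nat_power)
    then show ?thesis using that by (simp add: local_dim_seq_def divide_le_eq mult.commute)
  qed
  then have "\<kappa> \<le> local_dim \<nu> x" by (intro LIMSEQ_le_const[OF lim]) auto
  with lim show ?case by simp
qed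

lemma integrable_inverse_local_dim: "integrable \<nu> (\<lambda>x. 1 / local_dim \<nu> x)"
proof (rule integrable_const_bound[where B = "1 / \<kappa>"])
  show "AE x in \<nu>. norm (1 / local_dim \<nu> x) \<le> 1 / \<kappa>"
    using AE_local_dim
  proof eventually_elim
    case (elim x)
    then show ?case using kappa_pos frac_le[of 1 1 \<kappa> "local_dim \<nu> x"] by (simp add: abs_of_pos)
  qed
qed measurable

lemma borel_measurable_cell_count [measurable]: "cell_count \<tau> \<in> borel_measurable \<nu>"
proof -
  have "(\<lambda>x. cell_count \<tau> x) = (\<lambda>x. real (card {n. (\<tau> \<le> measure \<nu> (dyadic_cell n x))}))"
    by (simp add: cell_count_def)
  also have "\<dots> \<in> borel_measurable borel"
    by measurable
  finally show ?thesis by (simp cong: measurable_cong_sets add: sets_eq)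
qed

text \<open>With \<tau> = 2 powr - T a level is heavy exactly if -log of its cell mass is at most T,
  so \<open>tendsto_card_sublevel\<close> gives the limit at almost every point. For T \<ge> 1 the
  bound \<open>cell_count_le\<close> supplies a constant dominating function.\<close>

lemma cell_count_integral_limit:
  "((\<lambda>T. (\<integral>x. cell_count (2 powr - T) x \<partial>\<nu>) / T) \<longlongrightarrow> (\<integral>x. 1 / local_dim \<nu> x \<partial>\<nu>)) at_top"
proof -
  have "((\<lambda>T. \<integral>x. cell_count (2 powr - T) x / T \<partial>\<nu>) \<longlongrightarrow> (\<integral>x. 1 / local_dim \<nu> x \<partial>\<nu>)) at_top"
  proof (rule integral_dominated_convergence_at_top[where w = "\<lambda>_. 1 / \<kappa> + 1"])
    show "\<forall>\<^sub>F T in at_top. AE x in \<nu>. norm (cell_count (2 powr - T) x / T) \<le> 1 / \<kappa> + 1"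
      using eventually_ge_at_top[of 1]
    proof eventually_elim
      case (elim T)
      show ?case
        using AE_unit
      proof eventually_elim
        case (elim x)
        have "cell_count (2 powr - T) x \<le> T / \<kappa> + 1"
          using cell_count_le[OF elim, of "2 powr - T"] powr_mono[of "- T" 0 2] \<open>1 \<le> T\<close> by simp
        then have "cell_count (2 powr - T) x / T \<le> (T / \<kappa> + 1) / T" using \<open>1 \<le> T\<close> by (intro divide_right_mono) auto
        also have "\<dots> = 1 / \<kappa> + 1 / T" using \<open>1 \<le> T\<close> by (simp add: add_divide_distrib diff_divide_distrib)
        also have "\<dots> \<le> 1 / \<kappa> + 1" using \<open>1 \<le> T\<close> by simp
        finally show ?case using \<open>1 \<le> T\<close> by (simp add: cell_count_def)
      qed
    qed
    show "AE x in \<nu>. ((\<lambda>T. cell_count (2 powr - T) x / T) \<longlongrightarrow> 1 / local_dim \<nu> x) at_top"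
      using AE_local_dim AE_unit
    proof eventually_elim
      case (elim x)
      have "2 powr - T \<le> measure \<nu> (dyadic_cell n x) \<longleftrightarrow> - log 2 (measure \<nu> (dyadic_cell n x)) \<le> T" for n T
        using cell_pos[OF dyadic_cell_in_partition[OF elim(2)]]
        by (simp add: powr_le_iff minus_le_iff)
      then show ?case
        using tendsto_card_sublevel[of "\<lambda>n. - log 2 (measure \<nu> (dyadic_cell n x))" "local_dim \<nu> x"]
          elim kappa_pos by (simp add: cell_count_def local_dim_seq_def[abs_def])
    qed
  qed simp_all
  then show ?thesis by simp
qed

end

section \<open>Lower bound for the geometric mean error\<close>

lemma ennreal_suminf_indicator_eq_card:
  assumes "finite {n. P n}"
  shows "(\<Sum>n. indicator {n. P n} n) = (of_nat (card {n. P n}) :: ennreal)"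
proof -
  have "(\<Sum>n. indicator {n. P n} n) = (\<Sum>n\<in>{n. P n}. indicator {n. P n} n :: ennreal)"
    by (rule suminf_finite[OF assms]) simp
  also have "\<dots> = (\<Sum>n\<in>{n. P n}. 1)" by (rule sum.cong) auto
  finally show ?thesis by simp
qed

text \<open>Levels are counted from 0, so for d < 1 the number of n with d < 2^(-n) is the ceiling
  of -log d. For d \<ge> 1 the left side is truncated to 0 by \<open>ennreal\<close>.\<close>

lemma neg_log_infdist_le:
  assumes "0 < d"
  shows "ennreal (- log 2 d) \<le> (\<Sum>n. indicator {n. d < 1 / 2 ^ n} n)"
proof -
  define m where "m = nat \<lceil>- log 2 d\<rceil>"
  have "ennreal (- log 2 d) \<le> ennreal (real m)" unfolding m_def by (intro ennreal_leI real_nat_ceiling_ge)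
  also have "\<dots> = (\<Sum>n<m. indicator {n. d < 1 / 2 ^ n} n)"
  proof -
    have "d < 1 / 2 ^ n" if "n < m" for n
    proof -
      have "real n < - log 2 d" using that by (simp add: m_def nat_less_iff less_ceiling_iff zless_nat_eq_int_zless)
      then have "log 2 d < - real n" by simp
      then have "d < 2 powr - real n" using assms by (simp add: log_less_iff)
      then show ?thesis by (simp add: powr_minus_divide powr_realpow)
    qed
    then show ?thesis by (simp add: ennreal_of_nat_eq_real_of_nat)
  qed
  also have "\<dots> \<le> (\<Sum>n. indicator {n. d < 1 / 2 ^ n} n)"
    by (intro sum_le_suminf) auto
  finally show ?thesis .
qed

text \<open>Each of the first M terms is at most \<tau>; from M on the terms are dominated by a
  geometric series starting at \<tau>. With M of order log(1/\<tau>), the sum is O(\<tau>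
  log(1/\<tau>)).\<close>

lemma suminf_min_power_le:
  fixes \<rho> \<tau> :: real
  assumes rho: "0 < \<rho>" "\<rho> < 1" and tau: "0 < \<tau>" and M: "\<rho> ^ M \<le> \<tau>"
  shows "(\<Sum>n. ennreal (min \<tau> (\<rho> ^ n))) \<le> ennreal (\<tau> * (real M + 1 / (1 - \<rho>)))"
proof -
  have "(\<Sum>n. ennreal (min \<tau> (\<rho> ^ n)))
      = (\<Sum>n. ennreal (min \<tau> (\<rho> ^ (n + M)))) + (\<Sum>n<M. ennreal (min \<tau> (\<rho> ^ n)))"
    by (rule suminf_offset) simp
  also have "\<dots> \<le> (\<Sum>n. ennreal (\<tau> * \<rho> ^ n)) + (\<Sum>n<M. ennreal \<tau>)"
  proof (intro add_mono suminf_le sum_mono ennreal_leI)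
    fix n
    have "\<rho> ^ (n + M) \<le> \<tau> * \<rho> ^ n"
      using M rho by (simp add: power_add mult.commute mult_right_mono)
    then show "min \<tau> (\<rho> ^ (n + M)) \<le> \<tau> * \<rho> ^ n" by simp
  qed simp_all
  also have "(\<Sum>n. ennreal (\<tau> * \<rho> ^ n)) = ennreal (\<tau> * (1 / (1 - \<rho>)))"
    using rho tau by (intro suminf_ennreal_eq sums_mult geometric_sums) auto
  also have "(\<Sum>n<M. ennreal \<tau>) = ennreal (real M * \<tau>)"
    using tau by (simp add: ennreal_mult ennreal_of_nat_eq_real_of_nat)
  also have "ennreal (\<tau> * (1 / (1 - \<rho>))) + ennreal (real M * \<tau>) = ennreal (\<tau> * (real M + 1 / (1 - \<rho>)))"
    using rho tau by (subst ennreal_plus[symmetric]) (simp_all add: algebra_simps)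
  finally show ?thesis .
qed

lemma infdist_finite_less_iff:
  fixes x :: real
  assumes "finite A" "A \<noteq> {}"
  shows "infdist x A < r \<longleftrightarrow> (\<exists>a\<in>A. \<bar>x - a\<bar> < r)"
proof
  assume "infdist x A < r"
  moreover obtain a where "a \<in> A" "infdist x A = dist x a"
    using infdist_attains_inf[OF finite_imp_closed[OF assms(1)] assms(2)] by blast
  ultimately show "\<exists>a\<in>A. \<bar>x - a\<bar> < r" by (auto simp: dist_real_def)
next
  assume "\<exists>a\<in>A. \<bar>x - a\<bar> < r"
  then show "infdist x A < r" using infdist_le[of _ A x] by (force simp: dist_real_def intro: le_less_trans)
qed

context dyadic_regular_measure
begin

text \<open>A point close to A lies in a heavy cell or in one of at most three light cells per
  element of A. A light cell has mass below \<tau> and, by its level, at most \<rho> ^ n.\<close>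

lemma measure_near_finite_le:
  assumes A: "finite A" "A \<noteq> {}" and tau: "0 < \<tau>"
  shows "measure \<nu> {x. infdist x A < 1 / 2 ^ n}
    \<le> measure \<nu> {x \<in> {0..1}. \<tau> \<le> measure \<nu> (dyadic_cell n x)} + 3 * card A * min \<tau> (\<rho> ^ n)"
proof -
  \<comment> \<open>Light cells are listed by an element of A and an index offset. For the cells
    that are needed the index is nonnegative; if \<open>nat\<close> truncates a negative one to 0,
    the number of listed pairs is unaffected.\<close>
  define \<Q> where "\<Q> = {Q \<in> dyadic_partition n. measure \<nu> Q < \<tau> \<and>
      (\<exists>(a, j)\<in>A \<times> {- 1..1}. Q = dyadic_interval n (nat (\<lfloor>a * 2 ^ n\<rfloor> + j)))}"
  have meas [measurable]: "{x \<in> {0..1}. \<tau> \<le> measure \<nu> (dyadic_cell n x)} \<in> sets \<nu>"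
    unfolding sets_eq by measurable
  have Qs: "Q \<in> sets \<nu>" if "Q \<in> \<Q>" for Q using that by (auto simp: \<Q>_def sets_eq dyadic_partition_borel)
  have finQ: "finite \<Q>" by (simp add: \<Q>_def)
  have "\<Q> \<subseteq> (\<lambda>(a, j). dyadic_interval n (nat (\<lfloor>a * 2 ^ n\<rfloor> + j))) ` (A \<times> {- 1..1})"
    by (auto simp: \<Q>_def)
  then have "card \<Q> \<le> card (A \<times> {- 1..1 :: int})"
    using A by (meson finite_SigmaI finite_atLeastAtMost_int finite_imageI card_mono card_image_le order_trans)
  then have cardQ: "card \<Q> \<le> 3 * card A" by (simp add: card_cartesian_product)
  \<comment> \<open>The null point 1 is removed in order to apply
    \<open>dyadic_index_near\<close>.\<close>
  have sub: "AE x in \<nu>. x \<in> {x. infdist x A < 1 / 2 ^ n}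
      \<longrightarrow> x \<in> {x \<in> {0..1}. \<tau> \<le> measure \<nu> (dyadic_cell n x)} \<union> \<Union>\<Q>"
    using AE_unit AE_not_in_finite[OF finite.insertI[OF finite.emptyI], of 1]
  proof eventually_elim
    case (elim x)
    show ?case
    proof (intro impI, rule ccontr)
      assume "x \<in> {x. infdist x A < 1 / 2 ^ n}"
        "x \<notin> {x \<in> {0..1}. \<tau> \<le> measure \<nu> (dyadic_cell n x)} \<union> \<Union>\<Q>"
      note x = elim this
      then obtain a where a: "a \<in> A" "\<bar>x - a\<bar> < 1 / 2 ^ n" using infdist_finite_less_iff[OF A] by blast
      define j where "j = int (dyadic_index n x) - \<lfloor>a * 2 ^ n\<rfloor>"
      have "j \<in> {- 1..1}" using dyadic_index_near[of x a n] x a by (auto simp: j_def)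
      moreover have "dyadic_cell n x = dyadic_interval n (nat (\<lfloor>a * 2 ^ n\<rfloor> + j))"
        using x(1) by (simp add: dyadic_cell_eq j_def)
      moreover have "dyadic_cell n x \<in> dyadic_partition n" "x \<in> dyadic_cell n x"
        using dyadic_cell_in_partition[OF x(1)] mem_dyadic_cell[OF x(1)] by auto
      moreover have "measure \<nu> (dyadic_cell n x) < \<tau>" using x by auto
      ultimately have "dyadic_cell n x \<in> \<Q>" using a(1) unfolding \<Q>_def by blast
      then show False using x(4) \<open>x \<in> dyadic_cell n x\<close> by blast
    qed
  qed
  have "measure \<nu> {x. infdist x A < 1 / 2 ^ n}
      \<le> measure \<nu> ({x \<in> {0..1}. \<tau> \<le> measure \<nu> (dyadic_cell n x)} \<union> \<Union>\<Q>)"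
    by (intro finite_measure_mono_AE[OF sub] sets.Un meas sets.finite_Union finQ) (use Qs in auto)
  also have "\<dots> \<le> measure \<nu> {x \<in> {0..1}. \<tau> \<le> measure \<nu> (dyadic_cell n x)} + measure \<nu> (\<Union>\<Q>)"
    by (intro measure_Un_le meas sets.finite_Union finQ) (use Qs in auto)
  also have "measure \<nu> (\<Union>\<Q>) \<le> (\<Sum>Q\<in>\<Q>. measure \<nu> Q)"
    using measure_UNION_le[OF finQ, of "\<lambda>Q. Q" \<nu>] Qs by simp
  also have "\<dots> \<le> (\<Sum>Q\<in>\<Q>. min \<tau> (\<rho> ^ n))"
    using cell_le by (intro sum_mono) (auto simp: \<Q>_def)
  also have "\<dots> \<le> 3 * card A * min \<tau> (\<rho> ^ n)"
    using cardQ tau rho by (simp add: mult_right_mono flip: of_nat_le_iff[where 'a = real])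
  finally show ?thesis by simp
qed

lemma cell_count_nonneg: "0 \<le> cell_count \<tau> x"
  by (simp add: cell_count_def)

lemma integrable_cell_count:
  assumes "0 < \<tau>" "\<tau> \<le> 1" shows "integrable \<nu> (cell_count \<tau>)"
proof (rule integrable_const_bound)
  show "AE x in \<nu>. norm (cell_count \<tau> x) \<le> - log 2 \<tau> / \<kappa> + 1"
    using AE_unit
  proof eventually_elim
    case (elim x)
    show ?case using cell_count_le[OF elim assms] cell_count_nonneg[of \<tau> x] by simp
  qed
qed measurable

text \<open>Summed over n, the heavy parts reassemble to the integral of \<open>cell_count\<close>
  and the light parts are controlled by \<open>suminf_min_power_le\<close>. Only the positive part
  of -log d(x,A) is integrated, which suffices for an upper bound.\<close>

lemma nn_integral_neg_log_infdist_le: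
  fixes \<tau> :: real
  assumes A: "finite A" "A \<noteq> {}" and tau: "0 < \<tau>" "\<tau> \<le> 1"
  shows "(\<integral>\<^sup>+x. ennreal (- log 2 (infdist x A)) \<partial>\<nu>)
    \<le> ennreal ((\<integral>x. cell_count \<tau> x \<partial>\<nu>) + 3 * card A * \<tau> * (- log 2 \<tau> / \<kappa> + 1 + 1 / (1 - \<rho>)))"
proof -
  define B where "B n = {x. infdist x A < 1 / 2 ^ n}" for n
  define G where "G n = {x \<in> {0..1}. \<tau> \<le> measure \<nu> (dyadic_cell n x)}" for n
  have Bs [measurable]: "B n \<in> sets \<nu>" for n
    unfolding B_def sets_eq by (intro borel_open open_Collect_less continuous_intros)
  have Gs [measurable]: "G n \<in> sets \<nu>" for n
    unfolding G_def sets_eq by measurable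
  have "(\<integral>\<^sup>+x. ennreal (- log 2 (infdist x A)) \<partial>\<nu>) \<le> (\<integral>\<^sup>+x. (\<Sum>n. indicator (B n) x) \<partial>\<nu>)"
  proof (rule nn_integral_mono_AE)
    show "AE x in \<nu>. ennreal (- log 2 (infdist x A)) \<le> (\<Sum>n. indicator (B n) x)"
      using AE_not_in_finite[OF A(1)]
      proof eventually_elim
        case (elim x)
        then have "0 < infdist x A"
          using infdist_pos_not_in_closed[OF finite_imp_closed[OF A(1)] A(2)] by blast
        from neg_log_infdist_le[OF this] show ?case
          by (simp add: B_def indicator_def)
      qed
  qed
  also have "\<dots> = (\<Sum>n. emeasure \<nu> (B n))"
    by (subst nn_integral_suminf) auto
  also have "\<dots> \<le> (\<Sum>n. emeasure \<nu> (G n) + ennreal (3 * card A * min \<tau> (\<rho> ^ n)))"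
  proof (intro suminf_le summableI)
    fix n
    have "0 \<le> min \<tau> (\<rho> ^ n)" using tau rho by simp
    then have "0 \<le> 3 * card A * min \<tau> (\<rho> ^ n)" by simp
    then show "emeasure \<nu> (B n) \<le> emeasure \<nu> (G n) + ennreal (3 * card A * min \<tau> (\<rho> ^ n))"
      using measure_near_finite_le[OF A tau(1), of n]
      by (simp add: B_def G_def emeasure_eq_measure flip: ennreal_plus)
  qed
  also have "\<dots> = (\<Sum>n. emeasure \<nu> (G n)) + (\<Sum>n. ennreal (3 * card A * min \<tau> (\<rho> ^ n)))"
    by (rule suminf_add[symmetric]) auto
  also have "(\<Sum>n. emeasure \<nu> (G n)) = (\<integral>\<^sup>+x. (\<Sum>n. indicator (G n) x) \<partial>\<nu>)"
    by (subst nn_integral_suminf) auto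
  also have "\<dots> = (\<integral>\<^sup>+x. ennreal (cell_count \<tau> x) \<partial>\<nu>)"
  proof (rule nn_integral_cong_AE)
    show "AE x in \<nu>. (\<Sum>n. indicator (G n) x) = ennreal (cell_count \<tau> x)"
      using AE_unit
      proof eventually_elim
        case (elim x)
        have "(\<Sum>n. indicator (G n) x :: ennreal) = (\<Sum>n. indicator {n. \<tau> \<le> measure \<nu> (dyadic_cell n x)} n)"
          using elim by (simp add: G_def indicator_def)
        also have "\<dots> = of_nat (card {n. \<tau> \<le> measure \<nu> (dyadic_cell n x)})"
          by (rule ennreal_suminf_indicator_eq_card[OF finite_big_levels[OF elim tau]])
        finally show ?case by (simp add: cell_count_def ennreal_of_nat_eq_real_of_nat)
      qed
  qed
  also have "\<dots> = ennreal (\<integral>x. cell_count \<tau> x \<partial>\<nu>)"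
  proof (rule nn_integral_eq_integral)
    show "integrable \<nu> (cell_count \<tau>)" by (rule integrable_cell_count[OF tau])
  qed (simp add: cell_count_def)
  also have "(\<Sum>n. ennreal (3 * card A * min \<tau> (\<rho> ^ n)))
      \<le> ennreal (3 * card A * \<tau> * (- log 2 \<tau> / \<kappa> + 1 + 1 / (1 - \<rho>)))"
  proof -
    \<comment> \<open>The least exponent with \<rho> ^ M \<le> \<tau>, because -log \<tau> /
      \<kappa> = log \<tau> / log \<rho>.\<close>
    define M where "M = nat \<lceil>- log 2 \<tau> / \<kappa>\<rceil>"
    have nn: "0 \<le> - log 2 \<tau> / \<kappa>" using kappa_pos tau by (intro divide_nonneg_pos) auto
    then have M: "- log 2 \<tau> / \<kappa> \<le> real M" "real M \<le> - log 2 \<tau> / \<kappa> + 1"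
      unfolding M_def by linarith+
    have rM: "\<rho> ^ M \<le> \<tau>"
    proof -
      have "- log 2 \<tau> \<le> real M * \<kappa>"
        using M(1) kappa_pos by (simp only: pos_divide_le_eq)
      then have "log 2 (\<rho> ^ M) \<le> log 2 \<tau>" using rho by (simp add: log_nat_power)
      then show ?thesis using rho tau by (subst (asm) log_le_cancel_iff) auto
    qed
    have "(\<Sum>n. ennreal (3 * card A * min \<tau> (\<rho> ^ n))) = ennreal (3 * card A) * (\<Sum>n. ennreal (min \<tau> (\<rho> ^ n)))"
      using tau rho by (simp add: ennreal_mult)
    also have "\<dots> \<le> ennreal (3 * card A) * ennreal (\<tau> * (real M + 1 / (1 - \<rho>)))"
      by (intro mult_left_mono suminf_min_power_le rho tau rM) simp
    also have "\<dots> = ennreal (3 * card A * \<tau> * (real M + 1 / (1 - \<rho>)))"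
      using tau rho by (subst ennreal_mult[symmetric]) (simp_all add: mult.assoc)
    also have "\<dots> \<le> ennreal (3 * card A * \<tau> * (- log 2 \<tau> / \<kappa> + 1 + 1 / (1 - \<rho>)))"
      using M(2) tau by (intro ennreal_leI mult_left_mono) auto
    finally show ?thesis .
  qed
  also have "ennreal (\<integral>x. cell_count \<tau> x \<partial>\<nu>) + ennreal (3 * card A * \<tau> * (- log 2 \<tau> / \<kappa> + 1 + 1 / (1 - \<rho>)))
      = ennreal ((\<integral>x. cell_count \<tau> x \<partial>\<nu>) + 3 * card A * \<tau> * (- log 2 \<tau> / \<kappa> + 1 + 1 / (1 - \<rho>)))"
  proof (rule ennreal_plus[symmetric])
    show "0 \<le> (\<integral>x. cell_count \<tau> x \<partial>\<nu>)" by (rule Bochner_Integration.integral_nonneg) (rule cell_count_nonneg)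
    have "0 \<le> - log 2 \<tau> / \<kappa>" using kappa_pos tau by (intro divide_nonneg_pos) auto
    then show "0 \<le> 3 * card A * \<tau> * (- log 2 \<tau> / \<kappa> + 1 + 1 / (1 - \<rho>))"
      using rho tau by (intro mult_nonneg_nonneg add_nonneg_nonneg) auto
  qed
  finally show ?thesis by (simp add: add_left_mono)
qed

text \<open>The bound on the nonnegative integral must first be turned into integrability of ln
  d(x,A), since otherwise the geometric mean is 0 by definition. Where the logarithm is negative it
  is controlled by that integral; where it is nonnegative it is at most ln (1 + \<bar>a\<bar>) for
  any a in A, as x lies in the unit interval.\<close>

lemma geom_mean_dist_ge:
  fixes \<tau> :: real
  assumes A: "finite A" "A \<noteq> {}" and tau: "0 < \<tau>" "\<tau> \<le> 1"
  shows "2 powr - ((\<integral>x. cell_count \<tau> x \<partial>\<nu>) + 3 * card A * \<tau> * (- log 2 \<tau> / \<kappa> + 1 + 1 / (1 - \<rho>)))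
    \<le> geom_mean_dist \<nu> A"
proof -
  define B where "B = (\<integral>x. cell_count \<tau> x \<partial>\<nu>) + 3 * card A * \<tau> * (- log 2 \<tau> / \<kappa> + 1 + 1 / (1 - \<rho>))"
  have bound: "(\<integral>\<^sup>+x. ennreal (- log 2 (infdist x A)) \<partial>\<nu>) \<le> ennreal B"
    using nn_integral_neg_log_infdist_le[OF A tau] by (simp add: B_def)
  have "0 \<le> - log 2 \<tau> / \<kappa>" using kappa_pos tau by (intro divide_nonneg_pos) auto
  then have B0: "0 \<le> B"
    unfolding B_def using rho tau
    by (intro add_nonneg_nonneg mult_nonneg_nonneg Bochner_Integration.integral_nonneg cell_count_nonneg) auto
  have [measurable]: "(\<lambda>x. infdist x A) \<in> borel_measurable \<nu>"
    unfolding measurable_cong_sets[OF sets_eq refl]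
    by (intro borel_measurable_continuous_onI continuous_intros)
  have pos: "AE x in \<nu>. 0 < infdist x A"
    using AE_not_in_finite[OF A(1)]
  proof eventually_elim
    case (elim x)
    then show ?case using infdist_pos_not_in_closed[OF finite_imp_closed[OF A(1)] A(2)] by blast
  qed
  obtain a where a: "a \<in> A" using A by blast
  have bnd: "AE x in \<nu>. ennreal (norm (ln (infdist x A)))
      \<le> ennreal (ln 2) * ennreal (- log 2 (infdist x A)) + ennreal (ln (1 + \<bar>a\<bar>))"
    using pos AE_unit
  proof eventually_elim
    case (elim x)
    have "infdist x A \<le> 1 + \<bar>a\<bar>"
      using infdist_le[OF a, of x] elim by (auto simp: dist_real_def)
    then have le: "ln (infdist x A) \<le> ln (1 + \<bar>a\<bar>)" using elim by simp
    show ?case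
    proof (cases "0 \<le> ln (infdist x A)")
      case True
      then show ?thesis using le by (intro order_trans[OF _ add_increasing[OF _ order_refl]] ennreal_leI) auto
    next
      case False
      then have "norm (ln (infdist x A)) = ln 2 * - log 2 (infdist x A)" by (simp add: log_def)
      then have "ennreal (norm (ln (infdist x A))) = ennreal (ln 2) * ennreal (- log 2 (infdist x A))"
        using False by (subst ennreal_mult[symmetric]) (auto simp: log_def divide_nonpos_pos)
      then show ?thesis by simp
    qed
  qed
  have int: "integrable \<nu> (\<lambda>x. ln (infdist x A))"
  proof (rule integrableI_bounded)
    have "(\<integral>\<^sup>+x. ennreal (norm (ln (infdist x A))) \<partial>\<nu>)
        \<le> (\<integral>\<^sup>+x. ennreal (ln 2) * ennreal (- log 2 (infdist x A)) + ennreal (ln (1 + \<bar>a\<bar>)) \<partial>\<nu>)"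
      by (rule nn_integral_mono_AE[OF bnd])
    also have "\<dots> = ennreal (ln 2) * (\<integral>\<^sup>+x. ennreal (- log 2 (infdist x A)) \<partial>\<nu>) + ennreal (ln (1 + \<bar>a\<bar>))"
      using emeasure_space_1 by (subst nn_integral_add) (auto simp: nn_integral_cmult)
    also have "\<dots> \<le> ennreal (ln 2) * ennreal B + ennreal (ln (1 + \<bar>a\<bar>))"
      by (intro add_right_mono mult_left_mono bound) simp
    also have "\<dots> < \<infinity>" by (simp add: ennreal_mult_less_top)
    finally show "(\<integral>\<^sup>+x. ennreal (norm (ln (infdist x A))) \<partial>\<nu>) < \<infinity>" .
  qed measurable
  have "(\<integral>x. - log 2 (infdist x A) \<partial>\<nu>) \<le> B"
    by (rule integral_real_bounded[OF B0 bound])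
  then have "- B \<le> (\<integral>x. ln (infdist x A) \<partial>\<nu>) / ln 2" by (simp add: log_def)
  then have "2 powr - B \<le> 2 powr ((\<integral>x. ln (infdist x A) \<partial>\<nu>) / ln 2)" by (intro powr_mono) auto
  also have "\<dots> = geom_mean_dist \<nu> A"
    using pos int by (simp add: geom_mean_dist_def powr_def)
  finally show ?thesis by (simp add: B_def)
qed

lemma quant_error0_ge:
  fixes \<tau> :: real
  assumes N: "1 \<le> N" and tau: "0 < \<tau>" "\<tau> \<le> 1"
  shows "2 powr - ((\<integral>x. cell_count \<tau> x \<partial>\<nu>) + 3 * real N * \<tau> * (- log 2 \<tau> / \<kappa> + 1 + 1 / (1 - \<rho>)))
    \<le> quant_error0 N \<nu>"
  unfolding quant_error0_def
proof (rule cINF_greatest)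
  show "{A::real set. finite A \<and> 1 \<le> card A \<and> card A \<le> N} \<noteq> {}"
    using N by (auto intro!: exI[of _ "{0}"])
next
  fix A :: "real set" assume A: "A \<in> {A. finite A \<and> 1 \<le> card A \<and> card A \<le> N}"
  have "0 \<le> - log 2 \<tau> / \<kappa>" using kappa_pos tau by (intro divide_nonneg_pos) auto
  then have "3 * card A * \<tau> * (- log 2 \<tau> / \<kappa> + 1 + 1 / (1 - \<rho>)) \<le> 3 * real N * \<tau> * (- log 2 \<tau> / \<kappa> + 1 + 1 / (1 - \<rho>))"
    using A rho tau by (intro mult_right_mono) auto
  then have "2 powr - ((\<integral>x. cell_count \<tau> x \<partial>\<nu>) + 3 * real N * \<tau> * (- log 2 \<tau> / \<kappa> + 1 + 1 / (1 - \<rho>)))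
      \<le> 2 powr - ((\<integral>x. cell_count \<tau> x \<partial>\<nu>) + 3 * card A * \<tau> * (- log 2 \<tau> / \<kappa> + 1 + 1 / (1 - \<rho>)))"
    by (intro powr_mono) auto
  also have "\<dots> \<le> geom_mean_dist \<nu> A"
    using A tau by (intro geom_mean_dist_ge) auto
  finally show "2 powr - ((\<integral>x. cell_count \<tau> x \<partial>\<nu>) + 3 * real N * \<tau> * (- log 2 \<tau> / \<kappa> + 1 + 1 / (1 - \<rho>)))
      \<le> geom_mean_dist \<nu> A" .
qed

section \<open>Upper bound for the geometric mean error\<close>

lemma geom_mean_dist_nonneg: "0 \<le> geom_mean_dist \<nu> A"
  by (simp add: geom_mean_dist_def)

text \<open>Markov's inequality for the cells of one level, whose masses add up to 1.\<close>

lemma card_big_cells_le: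
  assumes tau: "0 < \<tau>"
  shows "real (card {Q \<in> dyadic_partition n. \<tau> \<le> measure \<nu> Q}) \<le> 1 / \<tau>"
proof -
  have "real (card {Q \<in> dyadic_partition n. \<tau> \<le> measure \<nu> Q}) * \<tau>
      = (\<Sum>Q\<in>{Q \<in> dyadic_partition n. \<tau> \<le> measure \<nu> Q}. \<tau>)" by simp
  also have "\<dots> \<le> (\<Sum>Q\<in>{Q \<in> dyadic_partition n. \<tau> \<le> measure \<nu> Q}. measure \<nu> Q)"
    by (rule sum_mono) simp
  also have "\<dots> \<le> (\<Sum>Q\<in>dyadic_partition n. measure \<nu> Q)"
    by (rule sum_mono2) auto
  finally show ?thesis using tau by (simp add: sum_measure_cells le_divide_eq)
qed

text \<open>The distance from x to the set is governed by the deepest heavy cell around x, which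
  contains a chosen point. The cardinality bound multiplies the number of possible heavy levels by
  the bound 1 / \<tau> for each level.\<close>

lemma exists_quantizer:
  fixes \<tau> :: real
  assumes tau: "0 < \<tau>" "\<tau> \<le> 1"
  obtains A where "finite A" "A \<noteq> {}" "real (card A) \<le> (- log 2 \<tau> / \<kappa> + 1) * (1 / \<tau>)"
    "geom_mean_dist \<nu> A \<le> 2 powr (1 - (\<integral>x. cell_count \<tau> x \<partial>\<nu>))"
proof
  \<comment> \<open>Beyond these levels \<rho> ^ n < \<tau>, so no cell is heavy.\<close>
  define L where "L = {n. real n \<le> - log 2 \<tau> / \<kappa>}"
  define \<Q> where "\<Q> = (\<Union>n\<in>L. {Q \<in> dyadic_partition n. \<tau> \<le> measure \<nu> Q})"
  define pt :: "real set \<Rightarrow> real" where "pt Q = (SOME y. y \<in> Q)" for Q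
  define A where "A = pt ` \<Q>"
  have nn: "0 \<le> - log 2 \<tau> / \<kappa>" using kappa_pos tau by (intro divide_nonneg_pos) auto
  have finL: "finite L" and cardL: "real (card L) \<le> - log 2 \<tau> / \<kappa> + 1"
    using card_nat_le_real[OF nn] by (simp_all add: L_def)
  have finQ: "finite \<Q>" using finL by (simp add: \<Q>_def)
  have pt: "pt Q \<in> Q" if "Q \<in> dyadic_partition n" for Q n
  proof -
    have "Q \<noteq> {}" using cell_pos[OF that] by auto
    then show ?thesis unfolding pt_def by (simp add: some_in_eq)
  qed
  show fin: "finite A" using finQ by (simp add: A_def)
  have "{0..1} \<in> \<Q>"
    unfolding \<Q>_def
  proof
    show "0 \<in> L" using nn by (simp add: L_def)
    show "{0..1} \<in> {Q \<in> dyadic_partition 0. \<tau> \<le> measure \<nu> Q}"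
      using tau emeasure_unit by (simp add: measure_def dyadic_partition_0)
  qed
  then show ne: "A \<noteq> {}" by (auto simp: A_def)
  have "card A \<le> card \<Q>" unfolding A_def by (rule card_image_le[OF finQ])
  also have "card \<Q> \<le> (\<Sum>n\<in>L. card {Q \<in> dyadic_partition n. \<tau> \<le> measure \<nu> Q})"
    unfolding \<Q>_def by (rule card_UN_le[OF finL])
  finally have "real (card A) \<le> real (\<Sum>n\<in>L. card {Q \<in> dyadic_partition n. \<tau> \<le> measure \<nu> Q})"
    by (rule of_nat_mono)
  also have "\<dots> \<le> (\<Sum>n\<in>L. 1 / \<tau>)"
    unfolding of_nat_sum by (rule sum_mono[OF card_big_cells_le[OF tau(1)]])
  also have "\<dots> = real (card L) * (1 / \<tau>)" by simp
  also have "\<dots> \<le> (- log 2 \<tau> / \<kappa> + 1) * (1 / \<tau>)"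
    using cardL tau by (intro mult_right_mono) auto
  finally show "real (card A) \<le> (- log 2 \<tau> / \<kappa> + 1) * (1 / \<tau>)" .
  show "geom_mean_dist \<nu> A \<le> 2 powr (1 - (\<integral>x. cell_count \<tau> x \<partial>\<nu>))"
  proof (cases "(AE x in \<nu>. infdist x A > 0) \<and> integrable \<nu> (\<lambda>x. ln (infdist x A))")
    case True
    have "(\<integral>x. ln (infdist x A) \<partial>\<nu>) \<le> (\<integral>x. ln 2 * (1 - cell_count \<tau> x) \<partial>\<nu>)"
    proof (rule integral_mono_AE)
      show "integrable \<nu> (\<lambda>x. ln 2 * (1 - cell_count \<tau> x))"
        using integrable_cell_count[OF tau] by simp
      have "AE x in \<nu>. infdist x A > 0" using True by simp
      then show "AE x in \<nu>. ln (infdist x A) \<le> ln 2 * (1 - cell_count \<tau> x)"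
        using AE_unit
      proof eventually_elim
        case (elim x)
        define S where "S = {n. \<tau> \<le> measure \<nu> (dyadic_cell n x)}"
        have finS: "finite S" unfolding S_def by (rule finite_big_levels[OF elim(2) tau])
        have "dyadic_cell 0 x = {0..1}"
          using dyadic_cell_in_partition[OF elim(2), of 0] by (simp add: dyadic_partition_0)
        then have "0 \<in> S" using tau emeasure_unit by (simp add: S_def measure_def)
        then have Max: "Max S \<in> S" using finS by (intro Max_in) auto
        \<comment> \<open>The heavy levels lie among 0, ..., \<open>Max S\<close>. Counting level 0
          costs the summand 1 in the exponent of the final bound.\<close>
        have "S \<subseteq> {..Max S}" using finS by auto
        then have "card S \<le> Suc (Max S)" using card_mono[of "{..Max S}" S] by simp
        then have cS: "cell_count \<tau> x \<le> 1 + real (Max S)"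
          by (simp add: cell_count_def S_def[symmetric])
        define Q where "Q = dyadic_cell (Max S) x"
        have Q: "Q \<in> dyadic_partition (Max S)" "x \<in> Q"
          unfolding Q_def using elim(2) by (auto intro: dyadic_cell_in_partition mem_dyadic_cell)
        have "Max S \<in> L" using Max big_levels_subset[OF elim(2) tau(1)] by (auto simp: S_def L_def)
        then have "Q \<in> \<Q>" using Max Q by (auto simp: \<Q>_def S_def Q_def)
        then have "infdist x A \<le> \<bar>x - pt Q\<bar>"
          using infdist_le[of "pt Q" A x] by (simp add: A_def dist_real_def)
        also have "\<dots> \<le> 1 / 2 ^ Max S" by (rule dyadic_partition_dist_le[OF Q pt[OF Q(1)]])
        finally have "ln (infdist x A) \<le> ln (1 / 2 ^ Max S)" using elim by simp
        also have "\<dots> = ln 2 * - real (Max S)" by (simp add: ln_div ln_realpow)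
        also have "\<dots> \<le> ln 2 * (1 - cell_count \<tau> x)" using cS by (intro mult_left_mono) auto
        finally show ?case .
      qed
    qed (use True in simp)
    also have "\<dots> = ln 2 * (1 - (\<integral>x. cell_count \<tau> x \<partial>\<nu>))"
      using integrable_cell_count[OF tau] prob_space by simp
    finally show ?thesis using True by (simp add: geom_mean_dist_def powr_def mult.commute)
  next
    \<comment> \<open>Here the geometric mean is 0 by definition.\<close>
    case False
    then show ?thesis by (auto simp: geom_mean_dist_def)
  qed
qed

lemma quant_error0_le:
  fixes \<tau> :: real
  assumes tau: "0 < \<tau>" "\<tau> \<le> 1" and N: "(- log 2 \<tau> / \<kappa> + 1) * (1 / \<tau>) \<le> real N"
  shows "quant_error0 N \<nu> \<le> 2 powr (1 - (\<integral>x. cell_count \<tau> x \<partial>\<nu>))"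
proof -
  obtain A where A: "finite A" "A \<noteq> {}" "real (card A) \<le> (- log 2 \<tau> / \<kappa> + 1) * (1 / \<tau>)"
    "geom_mean_dist \<nu> A \<le> 2 powr (1 - (\<integral>x. cell_count \<tau> x \<partial>\<nu>))"
    using exists_quantizer[OF tau] .
  have "bdd_below (geom_mean_dist \<nu> ` {A. finite A \<and> 1 \<le> card A \<and> card A \<le> N})"
    by (rule bdd_belowI[of _ 0]) (auto simp: geom_mean_dist_nonneg)
  moreover have "card A \<le> N" using A(3) N by linarith
  then have "A \<in> {A. finite A \<and> 1 \<le> card A \<and> card A \<le> N}" using A by (auto simp: Suc_le_eq card_gt_0_iff)
  ultimately have "quant_error0 N \<nu> \<le> geom_mean_dist \<nu> A"
    unfolding quant_error0_def by (rule cINF_lower)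
  then show ?thesis using A(4) by simp
qed

text \<open>Both thresholds have exponents asymptotic to log N, so after division by log N the two
  bounds on \<open>e N\<close> have the same limit I. The logarithmic corrections are large enough
  to absorb the number of levels and small enough to vanish in the limit.\<close>

theorem has_quant_dim0_inverse_local_dim:
  "has_quant_dim0 \<nu> (inverse (\<integral>x. 1 / local_dim \<nu> x \<partial>\<nu>))"
proof -
  define I where "I = (\<integral>x. 1 / local_dim \<nu> x \<partial>\<nu>)"
  define J where "J T = (\<integral>x. cell_count (2 powr - T) x \<partial>\<nu>)" for T
  define l where "l N = log 2 (real N)" for N
  define e where "e N = - log 2 (quant_error0 N \<nu>)" for N
  \<comment> \<open>Thresholds \<open>2 powr - T N = 1 / (N * l N)\<close> for the upper bound on \<open>e N\<close> and
    \<open>2 powr - S N = (l N)\<^sup>2 / N\<close> for the lower one.\<close>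
  define T where "T N = l N + log 2 (l N)" for N
  define S where "S N = l N - 2 * log 2 (l N)" for N
  define c where "c = 1 + 1 / (1 - \<rho>)"
  have J: "((\<lambda>T. J T / T) \<longlongrightarrow> I) at_top"
    unfolding J_def I_def by (rule cell_count_integral_limit)
  have limT: "filterlim T at_top sequentially" and limS: "filterlim S at_top sequentially"
    unfolding T_def S_def l_def by real_asymp+
  have Tl: "(\<lambda>N. T N / l N) \<longlonglongrightarrow> 1" and Sl: "(\<lambda>N. S N / l N) \<longlonglongrightarrow> 1"
    unfolding T_def S_def l_def by real_asymp+
  have l1: "(\<lambda>N. 1 / l N) \<longlonglongrightarrow> 0" unfolding l_def by real_asymp
  have lpos: "\<forall>\<^sub>F N in sequentially. 0 < l N" unfolding l_def by real_asymp
  have upper: "\<forall>\<^sub>F N in sequentially. 0 < quant_error0 N \<nu> \<and>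
      e N \<le> J (T N) + 3 * real N * 2 powr - T N * (T N / \<kappa> + c)"
    using eventually_ge_at_top[of 1] filterlim_at_top_dense[THEN iffD1, OF limT, rule_format, of 0]
  proof eventually_elim
    case (elim N)
    have ge: "2 powr - (J (T N) + 3 * real N * 2 powr - T N * (T N / \<kappa> + c)) \<le> quant_error0 N \<nu>"
      using quant_error0_ge[OF elim(1), of "2 powr - T N"] elim(2) powr_mono[of "- T N" 0 2]
      by (simp add: J_def c_def algebra_simps)
    moreover have "0 < 2 powr - (J (T N) + 3 * real N * 2 powr - T N * (T N / \<kappa> + c))" by simp
    ultimately have pos: "0 < quant_error0 N \<nu>" by linarith
    have "log 2 (2 powr - (J (T N) + 3 * real N * 2 powr - T N * (T N / \<kappa> + c))) \<le> log 2 (quant_error0 N \<nu>)"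
      using ge pos by (subst log_le_cancel_iff) auto
    then have "e N \<le> J (T N) + 3 * real N * 2 powr - T N * (T N / \<kappa> + c)" unfolding e_def by simp
    with pos show ?case by simp
  qed
  have "(\<lambda>N. S N / (l N)\<^sup>2) \<longlonglongrightarrow> 0" and "(\<lambda>N. 1 / (l N)\<^sup>2) \<longlonglongrightarrow> 0"
    unfolding S_def l_def by real_asymp+
  then have "(\<lambda>N. S N / (l N)\<^sup>2 * (1 / \<kappa>) + 1 / (l N)\<^sup>2) \<longlonglongrightarrow> 0 * (1 / \<kappa>) + 0"
    by (intro tendsto_intros)
  \<comment> \<open>The quantizer for the threshold 2 powr - S N has at most (S N / \<kappa> + 1) *
    2 powr S N points, which is N times the quantity below. The square of \<open>l N\<close> makes
    this quantity tend to 0, so the quantizer fits into N points.\<close>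
  then have small: "\<forall>\<^sub>F N in sequentially. S N / (l N)\<^sup>2 * (1 / \<kappa>) + 1 / (l N)\<^sup>2 < 1"
    by (rule order_tendstoD(2)) simp
  have powS: "2 powr S N = real N / (l N)\<^sup>2" and powT: "real N * 2 powr - T N = 1 / l N"
    if "1 \<le> N" "0 < l N" for N
  proof -
    have "2 powr l N = real N" using that unfolding l_def by (intro powr_log_cancel) auto
    moreover have "2 powr log 2 (l N) = l N" using that by (intro powr_log_cancel) auto
    ultimately show "2 powr S N = real N / (l N)\<^sup>2" "real N * 2 powr - T N = 1 / l N"
      using that unfolding S_def T_def mult_2 powr_diff powr_add powr_minus
      by (simp_all add: power2_eq_square inverse_eq_divide)
  qed
  have lower: "\<forall>\<^sub>F N in sequentially. J (S N) - 1 \<le> e N"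
    using small lpos eventually_ge_at_top[of 1] filterlim_at_top_dense[THEN iffD1, OF limS, rule_format, of 0] upper
  proof eventually_elim
    case (elim N)
    have "(S N / \<kappa> + 1) * 2 powr S N = (S N / (l N)\<^sup>2 * (1 / \<kappa>) + 1 / (l N)\<^sup>2) * real N"
      unfolding powS[OF elim(3,2)] by (simp add: algebra_simps)
    also have "\<dots> \<le> 1 * real N" using elim(1) by (intro mult_right_mono) auto
    also have "(S N / \<kappa> + 1) * 2 powr S N = (- log 2 (2 powr - S N) / \<kappa> + 1) * (1 / 2 powr - S N)"
    proof -
      have "log 2 (2 powr - S N) = - S N" "1 / 2 powr - S N = 2 powr S N"
        by (rule log_powr_cancel) (simp_all add: powr_minus_divide)
      then show ?thesis by (simp only: minus_minus)
    qed
    finally have "quant_error0 N \<nu> \<le> 2 powr (1 - J (S N))"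
      using quant_error0_le[of "2 powr - S N" N] elim powr_mono[of "- S N" 0 2]
      by (simp add: J_def)
    then have "log 2 (quant_error0 N \<nu>) \<le> log 2 (2 powr (1 - J (S N)))"
      using elim by (subst log_le_cancel_iff) auto
    then show ?case by (simp add: e_def)
  qed
  have "(\<lambda>N. e N / l N) \<longlonglongrightarrow> I"
  proof (rule tendsto_sandwich)
    show "\<forall>\<^sub>F N in sequentially. J (S N) / S N * (S N / l N) - 1 / l N \<le> e N / l N"
      using lower lpos filterlim_at_top_dense[THEN iffD1, OF limS, rule_format, of 0]
      by eventually_elim (simp add: divide_right_mono flip: diff_divide_distrib)
    have "(\<lambda>N. J (S N) / S N * (S N / l N) - 1 / l N) \<longlonglongrightarrow> I * 1 - 0"
      by (intro tendsto_intros Sl l1 filterlim_compose[OF J limS])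
    then show "(\<lambda>N. J (S N) / S N * (S N / l N) - 1 / l N) \<longlonglongrightarrow> I" by simp
    show "\<forall>\<^sub>F N in sequentially. e N / l N \<le> J (T N) / T N * (T N / l N)
        + 3 * (T N / (l N)\<^sup>2 * (1 / \<kappa>) + 1 / (l N)\<^sup>2 * c)"
      using upper lpos eventually_ge_at_top[of 1] filterlim_at_top_dense[THEN iffD1, OF limT, rule_format, of 0]
    proof eventually_elim
      case (elim N)
      have "e N / l N \<le> (J (T N) + 3 * real N * 2 powr - T N * (T N / \<kappa> + c)) / l N"
        using elim by (intro divide_right_mono) auto
      \<comment> \<open>The choice of T cancels N and leaves an error 3 (T N / \<kappa> + c) / l N.
        It stays bounded, as T N is asymptotic to \<open>l N\<close>, and vanishes after the
        division by \<open>l N\<close>.\<close>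
      also have "J (T N) + 3 * real N * 2 powr - T N * (T N / \<kappa> + c) = J (T N) + 3 * (1 / l N) * (T N / \<kappa> + c)"
        unfolding powT[OF elim(3,2), symmetric] by (simp only: mult.assoc)
      also have "(J (T N) + 3 * (1 / l N) * (T N / \<kappa> + c)) / l N = J (T N) / T N * (T N / l N)
        + 3 * (T N / (l N)\<^sup>2 * (1 / \<kappa>) + 1 / (l N)\<^sup>2 * c)"
        using elim(2,4) by (simp add: power2_eq_square add_divide_distrib diff_divide_distrib algebra_simps)
      finally show ?case .
    qed
    have "(\<lambda>N. T N / (l N)\<^sup>2) \<longlonglongrightarrow> 0" and "(\<lambda>N. 1 / (l N)\<^sup>2) \<longlonglongrightarrow> 0"
      unfolding T_def l_def by real_asymp+
    then have "(\<lambda>N. J (T N) / T N * (T N / l N)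
        + 3 * (T N / (l N)\<^sup>2 * (1 / \<kappa>) + 1 / (l N)\<^sup>2 * c))
        \<longlonglongrightarrow> I * 1 + 3 * (0 * (1 / \<kappa>) + 0 * c)"
      by (intro tendsto_intros Tl filterlim_compose[OF J limT])
    then show "(\<lambda>N. J (T N) / T N * (T N / l N)
        + 3 * (T N / (l N)\<^sup>2 * (1 / \<kappa>) + 1 / (l N)\<^sup>2 * c)) \<longlonglongrightarrow> I"
      by simp
  qed
  \<comment> \<open>Inverting the limit requires this; it holds because 1 / \<open>local_dim\<close>
    is positive almost everywhere.\<close>
  moreover have "I \<noteq> 0"
  proof
    assume "I = 0"
    moreover have "AE x in \<nu>. 0 \<le> 1 / local_dim \<nu> x"
      using AE_local_dim by eventually_elim (use kappa_pos in auto)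
    ultimately have "AE x in \<nu>. 1 / local_dim \<nu> x = 0"
      unfolding I_def by (subst (asm) integral_nonneg_eq_0_iff_AE[OF integrable_inverse_local_dim])
    with AE_local_dim have "AE x in \<nu>. False"
      by eventually_elim (use kappa_pos in auto)
    then show False by simp
  qed
  ultimately have "(\<lambda>N. inverse (e N / l N)) \<longlonglongrightarrow> inverse I" by (rule tendsto_inverse)
  then show ?thesis by (simp add: has_quant_dim0_def e_def l_def I_def)
qed

end

section \<open>Bernoulli digits\<close>

definition bernoulli_seq :: "real \<Rightarrow> (nat \<Rightarrow> bool) measure" where
  "bernoulli_seq p = (\<Pi>\<^sub>M j\<in>UNIV. measure_pmf (bernoulli_pmf p))"

definition digit_sum :: "(nat \<Rightarrow> bool) \<Rightarrow> real" where
  "digit_sum w = (\<Sum>j. of_bool (w j) / 2 ^ Suc j)"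

lemma digit_law_eq: "digit_law p = distr (bernoulli_seq p) borel digit_sum"
  by (simp add: digit_law_def bernoulli_seq_def digit_sum_def[abs_def])

lemma prob_space_bernoulli_seq: "prob_space (bernoulli_seq p)"
  unfolding bernoulli_seq_def by (intro prob_space_PiM measure_pmf.prob_space_axioms)

lemma sets_bernoulli_seq [measurable_cong]:
  "sets (bernoulli_seq p) = sets (\<Pi>\<^sub>M j\<in>(UNIV :: nat set). count_space UNIV)"
  unfolding bernoulli_seq_def by (intro sets_PiM_cong) simp_all

lemma space_bernoulli_seq [simp]: "space (bernoulli_seq p) = UNIV"
  by (simp add: bernoulli_seq_def space_PiM)

text \<open>The cylinders are formed over \<open>count_space UNIV\<close>, so that the generator of
  the \<sigma>-algebra is the same for all parameters, as the kernel property requires.\<close>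

lemma emeasure_bernoulli_seq_emb:
  assumes "finite J"
  shows "emeasure (bernoulli_seq p) (prod_emb UNIV (\<lambda>_. count_space UNIV) J (Pi\<^sub>E J X))
    = (\<Prod>j\<in>J. emeasure (bernoulli_pmf p) (X j))"
proof -
  interpret product_prob_space "\<lambda>_. measure_pmf (bernoulli_pmf p)" "UNIV :: nat set"
    by (intro product_prob_spaceI measure_pmf.prob_space_axioms)
  show ?thesis
    using emeasure_PiM_emb[of J X] assms by (simp add: bernoulli_seq_def prod_emb_def)
qed

lemma measure_bernoulli_seq_cylinder:
  assumes "0 \<le> p" "p \<le> 1"
  shows "measure (bernoulli_seq p) {w. \<forall>j<n. w j = b j} = (\<Prod>j<n. if b j then p else 1 - p)"
proof -
  interpret product_prob_space "\<lambda>_. measure_pmf (bernoulli_pmf p)" "UNIV :: nat set"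
    by (intro product_prob_spaceI measure_pmf.prob_space_axioms)
  have "emeasure (bernoulli_seq p) {w. \<forall>j<n. w j = b j} = (\<Prod>j<n. emeasure (bernoulli_pmf p) {b j})"
    using emeasure_PiM_Collect[of "{..<n}" "\<lambda>j. {b j}"] by (simp add: bernoulli_seq_def space_PiM Ball_def)
  also have "\<dots> = (\<Prod>j<n. ennreal (if b j then p else 1 - p))"
    using assms by (intro prod.cong) (simp_all add: emeasure_pmf_single)
  also have "\<dots> = ennreal (\<Prod>j<n. if b j then p else 1 - p)"
    using assms by (intro prod_ennreal) auto
  finally show ?thesis using assms by (simp add: measure_def prod_nonneg)
qed

lemma borel_measurable_digit_sum [measurable]:
  "digit_sum \<in> borel_measurable (\<Pi>\<^sub>M j\<in>(UNIV :: nat set). count_space UNIV)"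
  unfolding digit_sum_def[abs_def] by measurable

lemma borel_measurable_pmf_bernoulli [measurable]: "(\<lambda>p. pmf (bernoulli_pmf p) b) \<in> borel_measurable borel"
  by (simp add: bernoulli_pmf.rep_eq)

text \<open>Measurability in p need only be checked on the intersection-stable cylinders, whose mass
  is a finite product of one-digit probabilities. \<open>bernoulli_pmf\<close> clamps its parameter
  to the unit interval, so the kernel is defined on the whole line.\<close>

lemma bernoulli_seq_kernel:
  "bernoulli_seq \<in> borel \<rightarrow>\<^sub>M prob_algebra (\<Pi>\<^sub>M j\<in>(UNIV :: nat set). count_space UNIV)"
proof (rule measurable_prob_algebra_generated[OF sets_PiM Int_stable_prod_algebra prod_algebra_sets_into_space])
  fix A assume "A \<in> prod_algebra (UNIV :: nat set) (\<lambda>_. count_space (UNIV :: bool set))"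
  then obtain J X where A: "A = prod_emb UNIV (\<lambda>_. count_space UNIV) J (Pi\<^sub>E J X)" "finite J"
    by (rule prod_algebraE)
  have "(\<lambda>p. emeasure (bernoulli_pmf p) Y) \<in> borel_measurable borel" for Y
    by (subst emeasure_measure_pmf_finite) auto
  then show "(\<lambda>p. emeasure (bernoulli_seq p) A) \<in> borel_measurable borel"
    using A by (simp add: emeasure_bernoulli_seq_emb)
qed (simp_all add: prob_space_bernoulli_seq sets_bernoulli_seq)

lemma digit_law_kernel: "digit_law \<in> borel \<rightarrow>\<^sub>M prob_algebra borel"
  unfolding digit_law_eq[abs_def]
  by (rule measurable_compose[OF bernoulli_seq_kernel measurable_distr_prob_space]) measurable

lemma indep_vars_bernoulli_seq:
  "prob_space.indep_vars (bernoulli_seq p) (\<lambda>_. measure_pmf (bernoulli_pmf p)) (\<lambda>j w. w j) UNIV"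
proof -
  interpret product_prob_space "\<lambda>_. measure_pmf (bernoulli_pmf p)" "UNIV :: nat set"
    by (intro product_prob_spaceI measure_pmf.prob_space_axioms)
  show ?thesis
    unfolding bernoulli_seq_def
    by (subst P.indep_vars_iff_distr_eq_PiM') (simp_all add: PiM_component restrict_def distr_id)
qed

lemma distr_bernoulli_seq_component:
  "distr (bernoulli_seq p) borel (\<lambda>w. of_bool (w j) :: real) = distr (bernoulli_pmf p) borel of_bool"
proof -
  interpret product_prob_space "\<lambda>_. measure_pmf (bernoulli_pmf p)" "UNIV :: nat set"
    by (intro product_prob_spaceI measure_pmf.prob_space_axioms)
  have "distr (bernoulli_seq p) borel (\<lambda>w. of_bool (w j) :: real)
      = distr (distr (bernoulli_seq p) (bernoulli_pmf p) (\<lambda>w. w j)) borel of_bool"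
    by (subst distr_distr) (auto simp: comp_def bernoulli_seq_def)
  then show ?thesis using PiM_component[of j] by (simp add: bernoulli_seq_def)
qed

section \<open>Concentration of digit frequencies\<close>

lemma bernoulli_seq_deviation:
  assumes p: "0 \<le> p" "p \<le> 1" and e: "0 \<le> e" and n: "0 < n"
  shows "measure (bernoulli_seq p) {w. \<bar>(\<Sum>j<n. of_bool (w j)) / real n - p\<bar> \<ge> e} \<le> 2 * exp (- 2 * real n * e\<^sup>2)"
proof -
  interpret prob_space "bernoulli_seq p" by (rule prob_space_bernoulli_seq)
  interpret H: Hoeffding_ineq_iid "bernoulli_seq p" "{..<n}" "\<lambda>j w. of_bool (w j)" "\<lambda>w. of_bool (w 0)" 0 1 p
  proof unfold_locales
    show "indep_vars (\<lambda>_. borel) (\<lambda>j w. of_bool (w j) :: real) {..<n}"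
      by (rule indep_vars_compose2[OF indep_vars_subset[OF indep_vars_bernoulli_seq]]) auto
    show "p \<equiv> expectation (\<lambda>w. of_bool (w 0))"
    proof (rule eq_reflection)
      have "expectation (\<lambda>w. of_bool (w 0)) = (\<integral>x. x \<partial>distr (bernoulli_seq p) borel (\<lambda>w. of_bool (w 0) :: real))"
        by (subst integral_distr) auto
      also have "\<dots> = p"
        unfolding distr_bernoulli_seq_component using p by (subst integral_distr) auto
      finally show "p = expectation (\<lambda>w. of_bool (w 0))" by simp
    qed
  qed (auto simp: distr_bernoulli_seq_component)
  show ?thesis using H.Hoeffding_ineq_abs_ge'[OF e] n by (simp add: lessThan_empty_iff)
qed

lemma AE_bernoulli_seq_frequency:
  assumes p: "0 \<le> p" "p \<le> 1"
  shows "AE w in bernoulli_seq p. (\<lambda>n. (\<Sum>j<n. of_bool (w j)) / real n) \<longlonglongrightarrow> p"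
proof -
  interpret prob_space "bernoulli_seq p" by (rule prob_space_bernoulli_seq)
  have "AE w in bernoulli_seq p. \<forall>k. \<forall>\<^sub>F n in sequentially.
      w \<notin> {w. \<bar>(\<Sum>j<n. of_bool (w j)) / real n - p\<bar> \<ge> 1 / real (Suc k)}"
    unfolding AE_all_countable
  proof
    fix k
    \<comment> \<open>The shift to \<open>Suc n\<close> meets the condition of a positive number of
      digits in the deviation bound.\<close>
    define E where "E n = {w. \<bar>(\<Sum>j<Suc n. of_bool (w j)) / real (Suc n) - p\<bar> \<ge> 1 / real (Suc k)}" for n
    have "{w \<in> space (bernoulli_seq p). \<bar>(\<Sum>j<Suc n. of_bool (w j)) / real (Suc n) - p\<bar> \<ge> 1 / real (Suc k)} \<in> events" for n
      by measurable
    then have Es: "E n \<in> events" for n by (simp add: E_def)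
    have "summable (\<lambda>n. prob (E n))"
    proof (rule summable_comparison_test)
      \<comment> \<open>The deviation bound for m digits is 2 * r ^ m with r < 1, so Borel--Cantelli
        applies.\<close>
      define r where "r = exp (- 2 * (1 / real (Suc k))\<^sup>2)"
      have "prob (E n) \<le> 2 * r ^ Suc n" for n
      proof -
        have "prob (E n) \<le> 2 * exp (- 2 * real (Suc n) * (1 / real (Suc k))\<^sup>2)"
          unfolding E_def by (rule bernoulli_seq_deviation[OF p]) auto
        also have "- 2 * real (Suc n) * (1 / real (Suc k))\<^sup>2 = real (Suc n) * (- 2 * (1 / real (Suc k))\<^sup>2)"
          by (simp add: algebra_simps)
        finally show ?thesis unfolding r_def exp_of_nat_mult[symmetric] .
      qed
      then show "\<exists>N. \<forall>n\<ge>N. norm (prob (E n)) \<le> 2 * r ^ Suc n" by simp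
      show "summable (\<lambda>n. 2 * r ^ Suc n)"
        by (intro summable_mult summable_Suc_iff[THEN iffD2] summable_geometric) (simp add: r_def)
    qed
    then have "AE w in bernoulli_seq p. \<forall>\<^sub>F n in sequentially. w \<in> space (bernoulli_seq p) - E n"
      by (intro borel_cantelli_AE1 Es emeasure_finite) (simp_all add: less_top[symmetric])
    then show "AE w in bernoulli_seq p. \<forall>\<^sub>F n in sequentially.
      w \<notin> {w. \<bar>(\<Sum>j<n. of_bool (w j)) / real n - p\<bar> \<ge> 1 / real (Suc k)}"
      by eventually_elim (subst eventually_sequentially_Suc[symmetric], simp add: E_def)
  qed
  then show ?thesis
  proof eventually_elim
    case (elim w)
    show ?case
    proof (rule LIMSEQ_I)
      fix r :: real assume "0 < r"
      then obtain k where k: "1 / real (Suc k) < r" using nat_approx_posE by metis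
      from elim[rule_format, of k] show "\<exists>N. \<forall>n\<ge>N. norm ((\<Sum>j<n. of_bool (w j)) / real n - p) < r"
        unfolding eventually_sequentially using k by force
    qed
  qed
qed

text \<open>If all digits were 1 from some place on, their frequency would tend to 1 and not to p.
  This discards the expansions whose value is the right endpoint of the cell of a prefix.\<close>

lemma AE_bernoulli_seq_infinitely_often_0:
  assumes p: "0 \<le> p" "p < 1"
  shows "AE w in bernoulli_seq p. \<forall>n. \<exists>j\<ge>n. \<not> w j"
proof -
  have "AE w in bernoulli_seq p. (\<lambda>n. (\<Sum>j<n. of_bool (w j)) / real n) \<longlonglongrightarrow> p"
    by (rule AE_bernoulli_seq_frequency) (use p in auto)
  then show ?thesis
  proof eventually_elim
    case (elim w)
    show ?case
    proof (intro allI, rule ccontr)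
      fix n assume "\<not> (\<exists>j\<ge>n. \<not> w j)"
      then have w: "w j" if "n \<le> j" for j using that by blast
      have "1 - real n * (1 / real m) \<le> (\<Sum>j<m. of_bool (w j)) / real m" if "m > 0" for m
      proof -
        have "real m - real n = (\<Sum>j<m. 1) - (\<Sum>j<n. 1)" by simp
        also have "\<dots> \<le> (\<Sum>j<m. 1) - (\<Sum>j<m. of_bool (\<not> w j))"
        proof -
          have "(\<Sum>j<m. of_bool (\<not> w j) :: real) = (\<Sum>j\<in>{..<m} \<inter> {..<n}. of_bool (\<not> w j))"
            using w by (intro sum.mono_neutral_right) (auto simp flip: not_le)
          also have "\<dots> \<le> (\<Sum>j\<in>{..<m} \<inter> {..<n}. 1)" by (intro sum_mono) auto
          also have "\<dots> \<le> (\<Sum>j<n. 1)" by (intro sum_mono2) auto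
          finally show ?thesis by simp
        qed
        also have "\<dots> = (\<Sum>j<m. of_bool (w j))"
          unfolding sum_subtractf[symmetric] by (intro sum.cong) auto
        finally have "(real m - real n) / real m \<le> (\<Sum>j<m. of_bool (w j)) / real m"
          by (rule divide_right_mono) simp
        then show ?thesis using that by (simp add: diff_divide_distrib)
      qed
      moreover have "(\<lambda>m. 1 - real n * (1 / real m)) \<longlonglongrightarrow> 1 - real n * 0"
        by (intro tendsto_intros lim_1_over_n)
      ultimately have "1 - real n * 0 \<le> p"
        using elim by (intro LIMSEQ_le[of _ _ _ p]) (auto intro!: exI[of _ 1])
      then show False using p by simp
    qed
  qed
qed

section \<open>Binary prefixes as indices of dyadic cells\<close>

fun prefix_value :: "nat \<Rightarrow> (nat \<Rightarrow> bool) \<Rightarrow> nat" where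
  "prefix_value 0 w = 0"
| "prefix_value (Suc n) w = 2 * prefix_value n w + of_bool (w n)"

lemma prefix_value_less: "prefix_value n w < 2 ^ n"
  by (induction n) (auto simp: of_bool_def)

lemma prefix_value_eq_iff: "prefix_value n w = prefix_value n b \<longleftrightarrow> (\<forall>j<n. w j = b j)"
proof (induction n)
  case (Suc n)
  have "2 * x + of_bool P = 2 * y + of_bool Q \<longleftrightarrow> x = y \<and> P = Q" for x y :: nat and P Q
    by (cases P; cases Q; simp; presburger)
  then show ?case using Suc by (auto simp: less_Suc_eq)
qed simp

lemma prefix_value_surj: "k < 2 ^ n \<Longrightarrow> \<exists>b. prefix_value n b = k"
proof (induction n arbitrary: k)
  case (Suc n)
  then obtain b where b: "prefix_value n b = k div 2" by (metis less_mult_imp_div_less mult.commute power_Suc)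
  have "prefix_value n (b(n := odd k)) = prefix_value n b"
    by (simp add: prefix_value_eq_iff)
  then have "prefix_value (Suc n) (b(n := odd k)) = k" using b by (simp add: odd_two_times_div_two_succ)
  then show ?case by blast
qed simp

lemma summable_digits: "summable (\<lambda>j. of_bool (w j) / 2 ^ Suc j :: real)"
proof (rule summable_comparison_test)
  show "\<exists>N. \<forall>n\<ge>N. norm (of_bool (w n) / 2 ^ Suc n :: real) \<le> (1 / 2) ^ Suc n"
    by (auto simp: power_one_over)
  show "summable (\<lambda>n. (1 / 2 :: real) ^ Suc n)"
    by (intro summable_Suc_iff[THEN iffD2] summable_geometric) simp
qed

lemma digit_sum_nonneg: "0 \<le> digit_sum w"
  unfolding digit_sum_def by (intro suminf_nonneg summable_digits) simp

text \<open>The digit 0 at place j removes 1 / 2 ^ Suc j from the full series, whose sum is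
  1.\<close>

lemma digit_sum_less_1:
  assumes "\<not> w j" shows "digit_sum w < 1"
proof -
  have geo: "(\<lambda>i. 1 / 2 ^ Suc i - (if i = j then 1 / 2 ^ Suc j else 0)) sums (1 - 1 / 2 ^ Suc j :: real)"
    using power_half_series by (intro sums_diff sums_single[of j "\<lambda>_. 1 / 2 ^ Suc j"]) (simp_all add: power_one_over)
  have "digit_sum w \<le> (\<Sum>i. 1 / 2 ^ Suc i - (if i = j then 1 / 2 ^ Suc j else 0))"
    unfolding digit_sum_def using assms
    by (intro suminf_le summable_digits sums_summable[OF geo]) auto
  also have "\<dots> = 1 - 1 / 2 ^ Suc j" using geo by (rule sums_unique[symmetric])
  also have "\<dots> < 1" by simp
  finally show ?thesis .
qed

lemma digit_sum_split: "digit_sum w = (real (prefix_value n w) + digit_sum (\<lambda>j. w (j + n))) / 2 ^ n"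
proof -
  have "digit_sum w = (\<Sum>j. of_bool (w (j + n)) / 2 ^ Suc (j + n)) + (\<Sum>j<n. of_bool (w j) / 2 ^ Suc j)"
    unfolding digit_sum_def by (rule suminf_split_initial_segment[OF summable_digits])
  also have "(\<Sum>j. of_bool (w (j + n)) / 2 ^ Suc (j + n)) = (\<Sum>j. of_bool (w (j + n)) / 2 ^ Suc j / 2 ^ n :: real)"
    by (simp add: power_add mult.assoc)
  also have "\<dots> = digit_sum (\<lambda>j. w (j + n)) / 2 ^ n"
    unfolding digit_sum_def by (rule suminf_divide[OF summable_digits])
  also have "(\<Sum>j<n. of_bool (w j) / 2 ^ Suc j :: real) = real (prefix_value n w) / 2 ^ n"
    by (induction n) (auto simp: field_simps)
  finally show ?thesis by (simp add: add_divide_distrib)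
qed

text \<open>The digits after the prefix contribute a remainder in the unit interval, scaled by
  2^(-n). A later digit 0 makes the remainder less than 1; otherwise the sum would be the right
  endpoint, which all cells but the last exclude.\<close>

lemma digit_sum_in_cell:
  assumes "\<exists>j\<ge>n. \<not> w j"
  shows "digit_sum w \<in> dyadic_interval n (prefix_value n w)"
proof -
  define r where "r = digit_sum (\<lambda>j. w (j + n))"
  obtain j where "n \<le> j" "\<not> w j" using assms by blast
  then have r: "0 \<le> r" "r < 1"
    unfolding r_def using digit_sum_less_1[of "\<lambda>j. w (j + n)" "j - n"] by (auto intro: digit_sum_nonneg)
  have le: "real (prefix_value n w) + 1 \<le> 2 ^ n"
    using of_nat_mono[OF Suc_leI[OF prefix_value_less[of n w]], where 'a = real] by (simp add: add.commute)
  have x: "digit_sum w = (real (prefix_value n w) + r) / 2 ^ n"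
    unfolding r_def by (rule digit_sum_split)
  have "real (prefix_value n w) + r \<le> 2 ^ n" using le r by linarith
  then show ?thesis using r unfolding x dyadic_interval_def by (simp add: divide_right_mono divide_strict_right_mono)
qed

text \<open>Almost surely the digit sum lies in the cell exactly if the first n digits agree with b,
  so the cell has the mass of a cylinder. In the exponential form only the number of ones matters,
  ready for comparison with the entropy.\<close>

lemma measure_digit_law_cell:
  assumes p: "0 < p" "p < 1"
  shows "measure (digit_law p) (dyadic_interval n (prefix_value n b))
    = 2 powr ((\<Sum>j<n. of_bool (b j)) * log 2 p + (real n - (\<Sum>j<n. of_bool (b j))) * log 2 (1 - p))"
proof -
  interpret prob_space "bernoulli_seq p" by (rule prob_space_bernoulli_seq)
  have Q: "dyadic_interval n (prefix_value n b) \<in> dyadic_partition n"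
    using prefix_value_less by (auto simp: dyadic_partition_def)
  have "measure (digit_law p) (dyadic_interval n (prefix_value n b))
      = prob (digit_sum -` dyadic_interval n (prefix_value n b) \<inter> space (bernoulli_seq p))"
    unfolding digit_law_eq by (rule measure_distr) (use Q in auto)
  also have "\<dots> = prob {w. \<forall>j<n. w j = b j}"
  proof (rule finite_measure_eq_AE)
    have "AE w in bernoulli_seq p. \<forall>n. \<exists>j\<ge>n. \<not> w j"
      by (rule AE_bernoulli_seq_infinitely_often_0) (use p in auto)
    then show "AE w in bernoulli_seq p. w \<in> digit_sum -` dyadic_interval n (prefix_value n b) \<inter> space (bernoulli_seq p)
        \<longleftrightarrow> w \<in> {w. \<forall>j<n. w j = b j}"
    proof eventually_elim
      case (elim w)
      have "digit_sum w \<in> dyadic_interval n (prefix_value n w)"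
        by (rule digit_sum_in_cell) (use elim in blast)
      then have "digit_sum w \<in> dyadic_interval n (prefix_value n b) \<longleftrightarrow> prefix_value n w = prefix_value n b"
        by (auto simp: mem_dyadic_interval_iff[OF prefix_value_less])
      then show ?case by (simp add: prefix_value_eq_iff)
    qed
    show "digit_sum -` dyadic_interval n (prefix_value n b) \<inter> space (bernoulli_seq p) \<in> events"
      using Q by (intro measurable_sets[of _ _ borel]) auto
    have "{w \<in> space (bernoulli_seq p). \<forall>j<n. w j = b j} \<in> events" by measurable
    then show "{w. \<forall>j<n. w j = b j} \<in> events" by simp
  qed
  also have "\<dots> = (\<Prod>j<n. if b j then p else 1 - p)"
    by (rule measure_bernoulli_seq_cylinder) (use p in auto)
  also have "\<dots> = (\<Prod>j<n. 2 powr (of_bool (b j) * log 2 p + (1 - of_bool (b j)) * log 2 (1 - p)))"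
    using p by (intro prod.cong) auto
  also have "\<dots> = 2 powr (\<Sum>j<n. of_bool (b j) * log 2 p + (1 - of_bool (b j)) * log 2 (1 - p))"
    by (rule powr_sum[symmetric]) auto
  also have "(\<Sum>j<n. of_bool (b j) * log 2 p + (1 - of_bool (b j)) * log 2 (1 - p))
      = (\<Sum>j<n. of_bool (b j)) * log 2 p + (real n - (\<Sum>j<n. of_bool (b j))) * log 2 (1 - p)"
    by (simp add: sum.distrib sum_subtractf flip: sum_distrib_right)
  finally show ?thesis .
qed

lemma digit_law_unit:
  assumes p: "0 \<le> p" "p < 1" shows "emeasure (digit_law p) {0..1} = 1"
proof -
  interpret prob_space "bernoulli_seq p" by (rule prob_space_bernoulli_seq)
  have "AE w in bernoulli_seq p. digit_sum w \<in> {0..1}"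
    using AE_bernoulli_seq_infinitely_often_0[OF p]
  proof eventually_elim
    case (elim w)
    then obtain j where "\<not> w j" by blast
    then show ?case using digit_sum_less_1[of w j] digit_sum_nonneg[of w] by simp
  qed
  moreover have "digit_sum -` {0..1} \<inter> space (bernoulli_seq p) \<in> events"
    by (intro measurable_sets[of _ _ borel]) auto
  ultimately have "emeasure (bernoulli_seq p) (digit_sum -` {0..1} \<inter> space (bernoulli_seq p)) = 1"
    by (intro emeasure_eq_1_AE) auto
  then show ?thesis by (simp add: digit_law_eq emeasure_distr)
qed

section \<open>Mixtures of Bernoulli measures\<close>

text \<open>This is nonnegativity of relative entropy. The inequality a ln (b / a) \<le> b - a is
  added over the two digits, and its right sides cancel.\<close>

lemma binary_entropy_Gibbs:
  assumes "0 < p" "p < 1" "0 < q" "q < 1"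
  shows "q * log 2 p + (1 - q) * log 2 (1 - p) \<le> - binary_entropy q"
proof -
  have *: "a * ln b - a * ln a \<le> b - a" if "0 < a" "0 < b" for a b :: real
  proof -
    have "a * ln (b / a) \<le> a * (b / a - 1)"
      using that by (intro mult_left_mono ln_le_minus_one) auto
    then show ?thesis using that by (simp add: ln_div right_diff_distrib)
  qed
  have "q * ln p - q * ln q + ((1 - q) * ln (1 - p) - (1 - q) * ln (1 - q)) \<le> 0"
    using *[of q p] *[of "1 - q" "1 - p"] assms by simp
  then have "(q * ln p - q * ln q + ((1 - q) * ln (1 - p) - (1 - q) * ln (1 - q))) / ln 2 \<le> 0"
    by (intro divide_nonpos_pos) auto
  then show ?thesis
    by (simp add: binary_entropy_def log_def add_divide_distrib diff_divide_distrib)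
qed

lemma borel_measurable_binary_entropy [measurable]: "binary_entropy \<in> borel_measurable borel"
  unfolding binary_entropy_def[abs_def] by measurable

text \<open>A point having a null ball lies in a null interval with rational endpoints, and there
  are countably many of those. It supplies the parameters near q from which the mixture draws its
  lower bound.\<close>

lemma AE_mem_support:
  fixes M :: "real measure"
  assumes "prob_space M" "sets M = sets borel"
  shows "AE x in M. \<forall>d>0. 0 < measure M (ball x d)"
proof -
  interpret prob_space M by fact
  have "AE x in M. \<forall>(a, b) \<in> \<rat> \<times> \<rat>. measure M {a<..<b} = 0 \<longrightarrow> x \<notin> {a<..<b}"
  proof (subst AE_ball_countable)
    show "countable (\<rat> \<times> \<rat> :: (real \<times> real) set)" by (simp add: countable_rat)
    show "\<forall>y\<in>\<rat> \<times> \<rat>. AE x in M. case y of (a, b) \<Rightarrow> measure M {a<..<b} = 0 \<longrightarrow> x \<notin> {a<..<b}"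
    proof (clarify)
      fix a b :: real
      show "AE x in M. measure M {a<..<b} = 0 \<longrightarrow> x \<notin> {a<..<b}"
      proof (cases "measure M {a<..<b} = 0")
        case True
        then have "{a<..<b} \<in> null_sets M" using assms by (simp add: null_sets_def emeasure_eq_measure)
        from AE_not_in[OF this] show ?thesis by eventually_elim simp
      qed simp
    qed
  qed
  then show ?thesis
  proof eventually_elim
    case (elim x)
    show ?case
    proof (intro allI impI)
      fix d :: real assume d: "0 < d"
      obtain a b where ab: "a \<in> \<rat>" "b \<in> \<rat>" "x - d < a" "a < x" "x < b" "b < x + d"
        using Rats_dense_in_real[of "x - d" x] Rats_dense_in_real[of x "x + d"] d by auto
      then have "0 < measure M {a<..<b}" using elim by (auto simp: zero_less_measure_iff)
      also have "\<dots> \<le> measure M (ball x d)"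
        using ab assms by (intro finite_measure_mono) (auto simp: dist_real_def)
      finally show "0 < measure M (ball x d)" .
    qed
  qed
qed

text \<open>\<pi> is the law of the probability of the digit 1; for the theorem it is the image of
  \<eta> under the inverse entropy. The bound c keeps both digit probabilities between c and 1 -
  c.\<close>

locale digit_mixture_law = prob_space \<pi> for \<pi> :: "real measure" +
  fixes c :: real
  assumes sets_pi [measurable_cong]: "sets \<pi> = sets borel"
    and c: "0 < c" "c \<le> 1 / 2"
    and AE_c: "AE p in \<pi>. p \<in> {c..1 / 2}"
begin

text \<open>As a bind in the Giry monad along a measurable kernel, the mixture is a probability
  measure by construction.\<close>

definition mix :: "real measure" where
  "mix = \<pi> \<bind> digit_law"

lemma pi_prob_algebra: "\<pi> \<in> space (prob_algebra borel)"
  using sets_pi prob_space_axioms by (simp add: space_prob_algebra)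

lemma prob_space_mix: "prob_space mix"
  unfolding mix_def by (rule prob_space_bind'[OF pi_prob_algebra digit_law_kernel])

lemma sets_mix [measurable_cong]: "sets mix = sets borel"
  unfolding mix_def by (rule sets_bind'[OF pi_prob_algebra digit_law_kernel])

lemma prob_space_digit_law: "prob_space (digit_law p)"
  unfolding digit_law_eq by (rule prob_space.prob_space_distr[OF prob_space_bernoulli_seq]) measurable

lemma emeasure_mix: "E \<in> sets borel \<Longrightarrow> emeasure mix E = (\<integral>\<^sup>+p. emeasure (digit_law p) E \<partial>\<pi>)"
  unfolding mix_def by (rule emeasure_bind_prob_algebra[OF pi_prob_algebra digit_law_kernel])

lemma AE_mix:
  assumes "Measurable.pred borel P" and "AE p in \<pi>. AE x in digit_law p. P x"
  shows "AE x in mix. P x"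
proof -
  have "digit_law \<in> \<pi> \<rightarrow>\<^sub>M subprob_algebra borel"
    using measurable_prob_algebraD[OF digit_law_kernel] measurable_cong_sets[OF sets_pi refl] by simp
  from AE_bind[OF this assms(1)] assms(2) show ?thesis unfolding mix_def by blast
qed

lemma borel_measurable_measure_digit_law [measurable]:
  "E \<in> sets borel \<Longrightarrow> (\<lambda>p. measure (digit_law p) E) \<in> borel_measurable borel"
  using measurable_compose[OF measurable_prob_algebraD[OF digit_law_kernel] measurable_measure_subprob_algebra] by simp

lemma integrable_measure_digit_law:
  assumes [measurable]: "E \<in> sets borel" shows "integrable \<pi> (\<lambda>p. measure (digit_law p) E)"
  by (rule integrable_const_bound[where B = 1])
    (auto simp: prob_space.prob_le_1[OF prob_space_digit_law])

lemma measure_mix: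
  assumes [measurable]: "E \<in> sets borel" shows "measure mix E = (\<integral>p. measure (digit_law p) E \<partial>\<pi>)"
proof -
  have "emeasure mix E = (\<integral>\<^sup>+p. ennreal (measure (digit_law p) E) \<partial>\<pi>)"
    using emeasure_mix[OF assms]
    by (simp add: finite_measure.emeasure_eq_measure prob_space_digit_law prob_space.axioms(1))
  also have "\<dots> = ennreal (\<integral>p. measure (digit_law p) E \<partial>\<pi>)"
    by (rule nn_integral_eq_integral[OF integrable_measure_digit_law[OF assms]]) simp
  finally show ?thesis by (simp add: measure_def)
qed

lemma prefix_cell: "dyadic_interval n (prefix_value n b) \<in> dyadic_partition n"
  using prefix_value_less by (auto simp: dyadic_partition_def)

lemma prefix_cell_cases:
  assumes "Q \<in> dyadic_partition n"
  obtains b where "Q = dyadic_interval n (prefix_value n b)"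
  using assms prefix_value_surj by (force simp: dyadic_partition_def)

lemma log_bounds:
  assumes "p \<in> {c..1 / 2}"
  shows "log 2 c \<le> log 2 p" "log 2 p \<le> log 2 (1 - p)" "log 2 (1 - p) \<le> log 2 (1 - c)"
  using assms c by (subst log_le_cancel_iff; simp)+

lemma measure_digit_law_cell_bounds:
  assumes p: "p \<in> {c..1 / 2}" and Q: "Q \<in> dyadic_partition n"
  shows "c ^ n \<le> measure (digit_law p) Q" "measure (digit_law p) Q \<le> (1 - c) ^ n"
proof -
  obtain b where b: "Q = dyadic_interval n (prefix_value n b)" using Q by (rule prefix_cell_cases)
  define S :: real where "S = (\<Sum>j<n. of_bool (b j))"
  have S: "0 \<le> S" "S \<le> real n"
    using sum_mono[of "{..<n}" "\<lambda>j. of_bool (b j) :: real" "\<lambda>_. 1"] by (auto simp: S_def sum_nonneg)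
  have eq: "measure (digit_law p) Q = 2 powr (S * log 2 p + (real n - S) * log 2 (1 - p))"
    unfolding b S_def using p c by (intro measure_digit_law_cell) auto
  have lb: "S * log 2 c + (real n - S) * log 2 c \<le> S * log 2 p + (real n - S) * log 2 (1 - p)"
    using S log_bounds[OF p] by (intro add_mono mult_left_mono) auto
  have ub: "S * log 2 p + (real n - S) * log 2 (1 - p) \<le> S * log 2 (1 - c) + (real n - S) * log 2 (1 - c)"
    using S log_bounds[OF p] by (intro add_mono mult_left_mono) auto
  have pw: "2 powr (S * log 2 a + (real n - S) * log 2 a) = a ^ n" if "0 < a" for a
  proof -
    have "2 powr (S * log 2 a + (real n - S) * log 2 a) = 2 powr (log 2 a * real n)" by (simp add: algebra_simps)
    also have "\<dots> = a powr real n" using that by (simp add: powr_powr[symmetric])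
    finally show ?thesis using that by (simp add: powr_realpow)
  qed
  show "c ^ n \<le> measure (digit_law p) Q"
    unfolding eq pw[OF c(1), symmetric] using lb by (intro powr_mono) auto
  have "0 < 1 - c" using c by simp
  show "measure (digit_law p) Q \<le> (1 - c) ^ n"
    unfolding eq pw[OF \<open>0 < 1 - c\<close>, symmetric] using ub by (intro powr_mono) auto
qed

lemma measure_mix_cell_bounds:
  assumes Q: "Q \<in> dyadic_partition n"
  shows "c ^ n \<le> measure mix Q" "measure mix Q \<le> (1 - c) ^ n"
proof -
  have Qs: "Q \<in> sets borel" using Q by (rule dyadic_partition_borel)
  have "AE p in \<pi>. c ^ n \<le> measure (digit_law p) Q"
    using AE_c by eventually_elim (rule measure_digit_law_cell_bounds(1)[OF _ Q])
  then show "c ^ n \<le> measure mix Q"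
    unfolding measure_mix[OF Qs] by (rule integral_ge_const[OF integrable_measure_digit_law[OF Qs]])
  have "AE p in \<pi>. measure (digit_law p) Q \<le> (1 - c) ^ n"
    using AE_c by eventually_elim (rule measure_digit_law_cell_bounds(2)[OF _ Q])
  then show "measure mix Q \<le> (1 - c) ^ n"
    unfolding measure_mix[OF Qs] by (rule integral_le_const[OF integrable_measure_digit_law[OF Qs]])
qed

lemma mix_unit: "emeasure mix {0..1} = 1"
proof -
  have "emeasure mix {0..1} = (\<integral>\<^sup>+p. emeasure (digit_law p) {0..1} \<partial>\<pi>)"
    by (rule emeasure_mix) simp
  also have "\<dots> = (\<integral>\<^sup>+p. 1 \<partial>\<pi>)"
  proof (rule nn_integral_cong_AE)
    show "AE p in \<pi>. emeasure (digit_law p) {0..1} = 1"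
      using AE_c by eventually_elim (use c in \<open>auto intro!: digit_law_unit\<close>)
  qed
  finally show ?thesis by (simp add: emeasure_space_1)
qed

text \<open>The second bound keeps only the parameters within \<open>d\<close> of \<open>q\<close> in the mixture.\<close>

lemma local_dim_seq_mix_bounds:
  assumes q: "q \<in> {c..1 / 2}" and n: "0 < n" and w: "\<exists>j\<ge>n. \<not> w j"
  defines "f \<equiv> (\<Sum>j<n. of_bool (w j)) / real n"
  shows "binary_entropy q + \<bar>f - q\<bar> * log 2 c \<le> local_dim_seq mix (digit_sum w) n"
    and "\<And>d e. (\<And>p. p \<in> {c..1 / 2} \<Longrightarrow> \<bar>p - q\<bar> < d \<Longrightarrow>
              - binary_entropy q - e \<le> q * log 2 p + (1 - q) * log 2 (1 - p)) \<Longrightarrow>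
            0 < measure \<pi> (ball q d) \<Longrightarrow>
          local_dim_seq mix (digit_sum w) n
            \<le> binary_entropy q + e - \<bar>f - q\<bar> * log 2 c - log 2 (measure \<pi> (ball q d)) / real n"
proof -
  define Q where "Q = dyadic_interval n (prefix_value n w)"
  define g where "g p = 2 powr (real n * (f * log 2 p + (1 - f) * log 2 (1 - p)))" for p
  have Q: "Q \<in> dyadic_partition n" unfolding Q_def by (rule prefix_cell)
  then have Qs: "Q \<in> sets borel" by (rule dyadic_partition_borel)
  have "dyadic_cell n (digit_sum w) = Q"
    using dyadic_cell_unique[OF Q] digit_sum_in_cell[OF w] by (auto simp: Q_def)
  then have lds: "local_dim_seq mix (digit_sum w) n = - log 2 (measure mix Q) / real n"
    by (simp add: local_dim_seq_def)
  have pos: "0 < measure mix Q" using measure_mix_cell_bounds(1)[OF Q] c by (smt (verit) zero_less_power)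
  have g: "measure (digit_law p) Q = g p" if "p \<in> {c..1 / 2}" for p
  proof -
    have "(\<Sum>j<n. of_bool (w j)) = real n * f" using n by (simp add: f_def)
    then show ?thesis
      using measure_digit_law_cell[of p n w] that c by (simp add: Q_def g_def algebra_simps)
  qed
  \<comment> \<open>The exponent is affine in f with slope log p - log (1 - p), whose absolute value
    is at most -log c. Hence replacing f by q has a cost uniform in p.\<close>
  have dev: "\<bar>(f * log 2 p + (1 - f) * log 2 (1 - p)) - (q * log 2 p + (1 - q) * log 2 (1 - p))\<bar> \<le> \<bar>f - q\<bar> * - log 2 c"
    if p: "p \<in> {c..1 / 2}" for p
  proof -
    have "log 2 (1 - p) \<le> 0" using p c by (simp add: log_le_zero_cancel_iff)
    then have "\<bar>log 2 p - log 2 (1 - p)\<bar> \<le> - log 2 c" using log_bounds[OF p] by linarith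
    then have "\<bar>f - q\<bar> * \<bar>log 2 p - log 2 (1 - p)\<bar> \<le> \<bar>f - q\<bar> * - log 2 c" by (intro mult_left_mono) auto
    also have "\<bar>f - q\<bar> * \<bar>log 2 p - log 2 (1 - p)\<bar>
        = \<bar>(f * log 2 p + (1 - f) * log 2 (1 - p)) - (q * log 2 p + (1 - q) * log 2 (1 - p))\<bar>"
      unfolding abs_mult[symmetric] by (simp add: algebra_simps)
    finally show ?thesis by simp
  qed
  show "binary_entropy q + \<bar>f - q\<bar> * log 2 c \<le> local_dim_seq mix (digit_sum w) n"
  proof -
    \<comment> \<open>By Gibbs' inequality this bounds the cell mass for every admissible p, hence
      also the average.\<close>
    define B where "B = 2 powr (real n * (- binary_entropy q - \<bar>f - q\<bar> * log 2 c))"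
    have "measure mix Q \<le> B"
      unfolding measure_mix[OF Qs]
    proof (intro integral_le_const integrable_measure_digit_law Qs)
      show "AE p in \<pi>. measure (digit_law p) Q \<le> B"
        using AE_c
      proof eventually_elim
        case (elim p)
        have "q * log 2 p + (1 - q) * log 2 (1 - p) \<le> - binary_entropy q"
          using elim q c by (intro binary_entropy_Gibbs) auto
        then have "f * log 2 p + (1 - f) * log 2 (1 - p) \<le> - binary_entropy q - \<bar>f - q\<bar> * log 2 c"
          using dev[OF elim] by linarith
        then show ?case
          unfolding g[OF elim] g_def B_def by (intro powr_mono mult_left_mono) auto
      qed
    qed
    then have "log 2 (measure mix Q) \<le> log 2 B" using pos by (subst log_le_cancel_iff) (auto simp: B_def)
    also have "\<dots> = real n * (- binary_entropy q - \<bar>f - q\<bar> * log 2 c)" by (simp add: B_def)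
    finally show ?thesis unfolding lds using n by (simp add: field_simps)
  qed
  show "local_dim_seq mix (digit_sum w) n
      \<le> binary_entropy q + e - \<bar>f - q\<bar> * log 2 c - log 2 (measure \<pi> (ball q d)) / real n"
    if e: "\<And>p. p \<in> {c..1 / 2} \<Longrightarrow> \<bar>p - q\<bar> < d \<Longrightarrow>
              - binary_entropy q - e \<le> q * log 2 p + (1 - q) * log 2 (1 - p)"
      and ball: "0 < measure \<pi> (ball q d)" for d e
  proof -
    \<comment> \<open>Parameters in the ball give the cell at least this mass; the mass of the ball
      itself only contributes a constant, divided by n.\<close>
    define B where "B = 2 powr (real n * (- binary_entropy q - e + \<bar>f - q\<bar> * log 2 c))"
    have "measure \<pi> (ball q d) * B = (\<integral>p. indicator (ball q d) p * B \<partial>\<pi>)" using sets_pi by simp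
    also have "\<dots> \<le> (\<integral>p. measure (digit_law p) Q \<partial>\<pi>)"
    proof (rule integral_mono_AE)
      show "integrable \<pi> (\<lambda>p. indicator (ball q d) p * B)"
        using sets_pi by (intro integrable_mult_left integrable_real_indicator) (auto simp: emeasure_eq_measure)
      show "AE p in \<pi>. indicator (ball q d) p * B \<le> measure (digit_law p) Q"
        using AE_c
      proof eventually_elim
        case (elim p)
        show ?case
        proof (cases "p \<in> ball q d")
          case True
          then have "\<bar>p - q\<bar> < d" by (simp add: dist_real_def abs_minus_commute)
          then have "- binary_entropy q - e + \<bar>f - q\<bar> * log 2 c \<le> f * log 2 p + (1 - f) * log 2 (1 - p)"
            using e[OF elim] dev[OF elim] by linarith
          then have "B \<le> measure (digit_law p) Q"
            unfolding g[OF elim] g_def B_def by (intro powr_mono mult_left_mono) auto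
          then show ?thesis using True by simp
        qed simp
      qed
    qed (rule integrable_measure_digit_law[OF Qs])
    finally have "measure \<pi> (ball q d) * B \<le> measure mix Q" by (simp add: measure_mix[OF Qs])
    then have "log 2 (measure \<pi> (ball q d) * B) \<le> log 2 (measure mix Q)"
      using pos ball by (subst log_le_cancel_iff) (auto simp: B_def)
    then have "log 2 (measure \<pi> (ball q d)) + real n * (- binary_entropy q - e + \<bar>f - q\<bar> * log 2 c) \<le> log 2 (measure mix Q)"
      using ball by (simp add: B_def log_mult)
    then show ?thesis unfolding lds using n by (simp add: field_simps)
  qed
qed

lemma local_dim_seq_mix_tendsto:
  assumes q: "q \<in> {c..1 / 2}" and supp: "\<forall>d>0. 0 < measure \<pi> (ball q d)"
    and w: "\<forall>n. \<exists>j\<ge>n. \<not> w j" and lim: "(\<lambda>n. (\<Sum>j<n. of_bool (w j)) / real n) \<longlonglongrightarrow> q"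
  shows "local_dim_seq mix (digit_sum w) \<longlonglongrightarrow> binary_entropy q"
proof (rule order_tendstoI)
  define f where "f n = (\<Sum>j<n. of_bool (w j)) / real n" for n
  have fq: "(\<lambda>n. \<bar>f n - q\<bar>) \<longlonglongrightarrow> 0"
    using tendsto_rabs[OF tendsto_diff[OF lim tendsto_const[of q]]] by (simp add: f_def)
  {
    fix u assume u: "u < binary_entropy q"
    have "(\<lambda>n. binary_entropy q + \<bar>f n - q\<bar> * log 2 c) \<longlonglongrightarrow> binary_entropy q + 0 * log 2 c"
      by (intro tendsto_intros fq)
    then have "\<forall>\<^sub>F n in sequentially. u < binary_entropy q + \<bar>f n - q\<bar> * log 2 c"
      by (rule order_tendstoD(1)) (use u in simp)
    then show "\<forall>\<^sub>F n in sequentially. u < local_dim_seq mix (digit_sum w) n"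
      using eventually_gt_at_top[of 0]
    proof eventually_elim
      case (elim n)
      then show ?case using local_dim_seq_mix_bounds(1)[OF q elim(2) w[rule_format]] by (simp add: f_def)
    qed
  next
    fix u assume u: "binary_entropy q < u"
    define e where "e = (u - binary_entropy q) / 2"
    have e: "0 < e" "binary_entropy q + e < u" using u by (auto simp: e_def field_simps)
    have q01: "0 < q" "q < 1" using q c by auto
    \<comment> \<open>The cross entropy is continuous in p and equals -h(q) at p = q, which yields
      the radius d. As d is fixed before n, the term with log of the ball's mass tends to 0.\<close>
    have "((\<lambda>p. q * log 2 p + (1 - q) * log 2 (1 - p)) \<longlongrightarrow> q * log 2 q + (1 - q) * log 2 (1 - q)) (nhds q)"
      using q01 by (intro tendsto_intros filterlim_ident) auto
    then have "\<forall>\<^sub>F p in nhds q. - binary_entropy q - e < q * log 2 p + (1 - q) * log 2 (1 - p)"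
      by (rule order_tendstoD(1)) (use e in \<open>simp add: binary_entropy_def\<close>)
    then obtain d where d: "d > 0"
      "\<And>p. dist p q < d \<Longrightarrow> - binary_entropy q - e < q * log 2 p + (1 - q) * log 2 (1 - p)"
      unfolding eventually_nhds_metric by blast
    have "(\<lambda>n. binary_entropy q + e - \<bar>f n - q\<bar> * log 2 c - log 2 (measure \<pi> (ball q d)) / real n)
        \<longlonglongrightarrow> binary_entropy q + e - 0 * log 2 c - 0"
      by (intro tendsto_intros fq lim_const_over_n)
    then have "\<forall>\<^sub>F n in sequentially.
        binary_entropy q + e - \<bar>f n - q\<bar> * log 2 c - log 2 (measure \<pi> (ball q d)) / real n < u"
      by (rule order_tendstoD(2)) (use e in simp)
    then show "\<forall>\<^sub>F n in sequentially. local_dim_seq mix (digit_sum w) n < u"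
      using eventually_gt_at_top[of 0]
    proof eventually_elim
      case (elim n)
      have "local_dim_seq mix (digit_sum w) n
          \<le> binary_entropy q + e - \<bar>f n - q\<bar> * log 2 c - log 2 (measure \<pi> (ball q d)) / real n"
        unfolding f_def using d supp
        by (intro local_dim_seq_mix_bounds(2)[OF q elim(2) w[rule_format]]) (auto simp: dist_real_def less_imp_le)
      then show ?case using elim by simp
    qed
  }
qed

lemma pred_local_dim_eq [measurable]:
  "Measurable.pred borel (\<lambda>x. convergent (local_dim_seq mix x) \<and> local_dim mix x = h)"
  \<comment> \<open>Convergence is measurable through the Cauchy criterion.\<close>
  unfolding Cauchy_convergent_iff[symmetric] by measurable

text \<open>The point is drawn from a single component p while the cell masses are those of the
  whole mixture. The iterated form lets the exceptional null set depend on p, which is what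
  integration over \<pi> allows.\<close>

lemma AE_local_dim_digit_law:
  "AE p in \<pi>. AE x in digit_law p. convergent (local_dim_seq mix x) \<and> local_dim mix x = binary_entropy p"
  using AE_c AE_mem_support[OF prob_space_axioms sets_pi]
proof eventually_elim
  case (elim p)
  have p: "0 \<le> p" "p < 1" "p \<le> 1" using elim c by auto
  have "AE w in bernoulli_seq p. convergent (local_dim_seq mix (digit_sum w)) \<and> local_dim mix (digit_sum w) = binary_entropy p"
    using AE_bernoulli_seq_infinitely_often_0[OF p(1,2)] AE_bernoulli_seq_frequency[OF p(1,3)]
  proof eventually_elim
    case (elim w)
    have "local_dim_seq mix (digit_sum w) \<longlonglongrightarrow> binary_entropy p"
      by (rule local_dim_seq_mix_tendsto) fact+
    then show ?case by (auto simp: convergent_def local_dim_def limI)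
  qed
  then show ?case
    unfolding digit_law_eq by (subst AE_distr_iff) (auto simp: pred_def[symmetric])
qed

text \<open>Under each component the local dimension is almost surely constant, so a preimage has
  mass 0 or 1 there. Integrating this indicator over the parameter gives the image of \<pi> under
  the entropy.\<close>

lemma distr_local_dim_mix: "distr mix borel (local_dim mix) = distr \<pi> borel binary_entropy"
proof (rule measure_eqI)
  fix E assume "E \<in> sets (distr mix borel (local_dim mix))"
  then have E [measurable]: "E \<in> sets borel" by simp
  have V [measurable]: "local_dim mix -` E \<in> sets borel"
    using measurable_sets[OF borel_measurable_local_dim E] by simp
  have "emeasure (distr mix borel (local_dim mix)) E = emeasure mix (local_dim mix -` E)"
    by (subst emeasure_distr) (simp_all add: sets_eq_imp_space_eq[OF sets_mix])
  also have "\<dots> = (\<integral>\<^sup>+p. emeasure (digit_law p) (local_dim mix -` E) \<partial>\<pi>)" by (rule emeasure_mix[OF V])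
  also have "\<dots> = (\<integral>\<^sup>+p. indicator E (binary_entropy p) \<partial>\<pi>)"
  proof (rule nn_integral_cong_AE)
    show "AE p in \<pi>. emeasure (digit_law p) (local_dim mix -` E) = indicator E (binary_entropy p)"
      using AE_local_dim_digit_law
    proof eventually_elim
      case (elim p)
      interpret D: prob_space "digit_law p" by (rule prob_space_digit_law)
      have s: "sets (digit_law p) = sets borel" by (simp add: digit_law_eq)
      show ?case
      proof (cases "binary_entropy p \<in> E")
        case True
        have "AE x in digit_law p. x \<in> local_dim mix -` E"
          using elim by eventually_elim (use True in auto)
        then have "emeasure (digit_law p) (local_dim mix -` E) = 1"
          by (intro D.emeasure_eq_1_AE) (auto simp: s)
        then show ?thesis using True by simp
      next
        case False
        have "AE x in digit_law p. x \<notin> local_dim mix -` E"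
          using elim by eventually_elim (use False in auto)
        then have "emeasure (digit_law p) (local_dim mix -` E) = 0"
          by (subst (asm) AE_iff_measurable[of "local_dim mix -` E"]) (auto simp: s digit_law_eq)
        then show ?thesis using False by simp
      qed
    qed
  qed
  also have "\<dots> = emeasure (distr \<pi> borel binary_entropy) E"
  proof -
    have "emeasure (distr \<pi> borel binary_entropy) E = (\<integral>\<^sup>+y. indicator E y \<partial>distr \<pi> borel binary_entropy)" by simp
    also have "\<dots> = (\<integral>\<^sup>+p. indicator E (binary_entropy p) \<partial>\<pi>)" by (rule nn_integral_distr) auto
    finally show ?thesis by simp
  qed
  finally show "emeasure (distr mix borel (local_dim mix)) E = emeasure (distr \<pi> borel binary_entropy) E" .
qed simp

sublocale regular: dyadic_regular_measure mix "1 - c"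
proof -
  interpret mix: prob_space mix by (rule prob_space_mix)
  show "dyadic_regular_measure mix (1 - c)"
  proof
    show "AE x in mix. convergent (local_dim_seq mix x)"
    proof (rule AE_mix)
      show "AE p in \<pi>. AE x in digit_law p. convergent (local_dim_seq mix x)"
        using AE_local_dim_digit_law by (auto elim!: eventually_mono)
      show "Measurable.pred borel (\<lambda>x. convergent (local_dim_seq mix x))"
        unfolding Cauchy_convergent_iff[symmetric] by measurable
    qed
    show "0 < measure mix Q" if "Q \<in> dyadic_partition n" for n Q
      using measure_mix_cell_bounds(1)[OF that] c by (smt (verit) zero_less_power)
  qed (use c sets_mix mix_unit measure_mix_cell_bounds(2) in auto)
qed

section \<open>Entropy, quantization dimension and support of the mixture\<close>

lemma integral_local_dim_mix:
  fixes g :: "real \<Rightarrow> real"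
  assumes [measurable]: "g \<in> borel_measurable borel"
  shows "(\<integral>x. g (local_dim mix x) \<partial>mix) = (\<integral>p. g (binary_entropy p) \<partial>\<pi>)"
proof -
  have "(\<integral>x. g (local_dim mix x) \<partial>mix) = (\<integral>y. g y \<partial>distr mix borel (local_dim mix))"
    by (subst integral_distr) auto
  also have "\<dots> = (\<integral>p. g (binary_entropy p) \<partial>\<pi>)"
    unfolding distr_local_dim_mix by (subst integral_distr) auto
  finally show ?thesis .
qed

lemma has_quant_dim0_mix: "has_quant_dim0 mix (inverse (\<integral>p. inverse (binary_entropy p) \<partial>\<pi>))"
  using regular.has_quant_dim0_inverse_local_dim integral_local_dim_mix[of inverse]
  by (simp add: inverse_eq_divide)

text \<open>The normalized partition entropy is the integral of the k-th local exponent. Cell masses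
  between c ^ k and 1 keep this exponent between 0 and -log c, so dominated convergence
  applies.\<close>

lemma has_entropy_dim_mix: "has_entropy_dim mix (\<integral>p. binary_entropy p \<partial>\<pi>)"
proof -
  have eq: "(\<integral>x. local_dim_seq mix x k \<partial>mix)
      = - (1 / real k) * (\<Sum>Q\<in>dyadic_partition k. measure mix Q * log 2 (measure mix Q))" for k
  proof -
    have "(\<integral>x. local_dim_seq mix x k \<partial>mix)
        = (\<integral>x. (\<Sum>Q\<in>dyadic_partition k. indicator Q x * (- log 2 (measure mix Q) / real k)) \<partial>mix)"
    proof (rule integral_cong_AE)
      show "AE x in mix. local_dim_seq mix x k
          = (\<Sum>Q\<in>dyadic_partition k. indicator Q x * (- log 2 (measure mix Q) / real k))"
        using regular.AE_unit
        by eventually_elim (simp only: local_dim_seq_def sum_indicator_dyadic)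
    qed (auto intro!: borel_measurable_sum borel_measurable_times borel_measurable_indicator
          simp: sets_mix dyadic_partition_borel)
    also have "\<dots> = (\<Sum>Q\<in>dyadic_partition k. \<integral>x. indicator Q x * (- log 2 (measure mix Q) / real k) \<partial>mix)"
      by (intro Bochner_Integration.integral_sum integrable_mult_left integrable_real_indicator)
        (auto simp: sets_mix dyadic_partition_borel regular.emeasure_eq_measure)
    also have "\<dots> = (\<Sum>Q\<in>dyadic_partition k. measure mix Q * (- log 2 (measure mix Q) / real k))"
      by (intro sum.cong) (auto simp: sets_mix dyadic_partition_borel)
    also have "\<dots> = - (1 / real k) * (\<Sum>Q\<in>dyadic_partition k. measure mix Q * log 2 (measure mix Q))"
      by (simp add: sum_distrib_left sum_negf sum_divide_distrib)
    finally show ?thesis .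
  qed
  have "(\<lambda>k. \<integral>x. local_dim_seq mix x k \<partial>mix) \<longlonglongrightarrow> (\<integral>x. local_dim mix x \<partial>mix)"
  proof (rule integral_dominated_convergence[where w = "\<lambda>_. - log 2 c"])
    show "AE x in mix. (\<lambda>k. local_dim_seq mix x k) \<longlonglongrightarrow> local_dim mix x"
      using regular.AE_local_dim by (auto elim!: eventually_mono)
    fix k
    show "AE x in mix. norm (local_dim_seq mix x k) \<le> - log 2 c"
      using regular.AE_unit
    proof eventually_elim
      case (elim x)
      define m where "m = measure mix (dyadic_cell k x)"
      have Q: "dyadic_cell k x \<in> dyadic_partition k" by (rule dyadic_cell_in_partition[OF elim])
      have m: "c ^ k \<le> m" "0 < m" "m \<le> 1"
        unfolding m_def using measure_mix_cell_bounds(1)[OF Q] regular.cell_pos[OF Q] regular.prob_le_1 by auto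
      have "log 2 (c ^ k) \<le> log 2 m" using m c by (subst log_le_cancel_iff) auto
      then have "- log 2 m \<le> real k * - log 2 c" using c by (simp add: log_nat_power)
      moreover have "log 2 m \<le> 0" using m by (simp add: log_le_zero_cancel_iff)
      moreover have "log 2 c \<le> 0" using c by (simp add: log_le_zero_cancel_iff)
      ultimately show ?case
        unfolding local_dim_seq_def m_def[symmetric]
        by (cases "k = 0") (auto simp: abs_if divide_le_eq field_simps)
    qed
  qed auto
  then show ?thesis
    unfolding has_entropy_dim_def eq[symmetric] using integral_local_dim_mix[of "\<lambda>y. y"] by simp
qed

lemma measure_support_mix: "measure_support mix = {0..1}"
proof (intro set_eqI iffI)
  fix x assume x: "x \<in> measure_support mix"
  show "x \<in> {0..1}"
  proof (rule ccontr)
    assume "x \<notin> {0..1}"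
    moreover have "open (- {0..1::real})" by (simp add: open_Compl)
    ultimately have "0 < emeasure mix (- {0..1})" using x unfolding measure_support_def by blast
    moreover have "emeasure mix (- {0..1}) = 0"
      using regular.AE_unit by (subst (asm) AE_iff_measurable[of "- {0..1}"]) (auto simp: sets_mix)
    ultimately show False by simp
  qed
next
  fix x :: real assume x: "x \<in> {0..1}"
  show "x \<in> measure_support mix"
    unfolding measure_support_def
  proof (intro CollectI allI impI)
    fix U :: "real set" assume U: "open U" "x \<in> U"
    then obtain e where e: "0 < e" "ball x e \<subseteq> U" using openE by blast
    obtain n where n: "(1 / 2) ^ n < e" using real_arch_pow_inv[OF e(1), of "1 / 2"] by auto
    define Q where "Q = dyadic_cell n x"
    have Q: "Q \<in> dyadic_partition n" "x \<in> Q"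
      unfolding Q_def using x by (auto intro: dyadic_cell_in_partition mem_dyadic_cell)
    have "Q \<subseteq> ball x e"
    proof
      fix y assume "y \<in> Q"
      then have "\<bar>x - y\<bar> \<le> 1 / 2 ^ n" using dyadic_partition_dist_le[OF Q] by blast
      then show "y \<in> ball x e" using n by (simp add: dist_real_def power_one_over)
    qed
    then have "emeasure mix Q \<le> emeasure mix U"
      using e U Q by (intro emeasure_mono) (auto simp: sets_mix)
    moreover have "0 < emeasure mix Q"
      using regular.cell_pos[OF Q(1)] by (simp add: regular.emeasure_eq_measure)
    ultimately show "0 < emeasure mix U" by (rule less_le_trans[rotated])
  qed
qed

end

section \<open>Inverting the binary entropy\<close>

lemma binary_entropy_0 [simp]: "binary_entropy 0 = 0"
  by (simp add: binary_entropy_def)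

lemma binary_entropy_half [simp]: "binary_entropy (1 / 2) = 1"
  by (simp add: binary_entropy_def log_divide)

text \<open>The derivative log ((1 - x) / x) is positive below 1/2; it vanishes at 1/2, so it is
  used only on the open interval.\<close>

lemma binary_entropy_strict_mono:
  assumes "0 < p" "p < q" "q \<le> 1 / 2"
  shows "binary_entropy p < binary_entropy q"
proof (rule DERIV_pos_imp_increasing_open[OF assms(2)])
  fix x assume x: "p < x" "x < q"
  have "(binary_entropy has_real_derivative (log 2 (1 - x) - log 2 x)) (at x)"
  proof -
    have "((\<lambda>x. (- x * ln x - (1 - x) * ln (1 - x)) / ln 2) has_real_derivative (ln (1 - x) - ln x) / ln 2) (at x)"
      using x assms by (auto intro!: derivative_eq_intros)
    then show ?thesis by (simp add: binary_entropy_def[abs_def] log_def diff_divide_distrib)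
  qed
  moreover have "0 < log 2 (1 - x) - log 2 x" using x assms by simp
  ultimately show "\<exists>y. (binary_entropy has_real_derivative y) (at x) \<and> 0 < y" by blast
next
  show "continuous_on {p..q} binary_entropy"
    unfolding binary_entropy_def[abs_def] using assms by (intro continuous_intros) auto
qed

lemma binary_entropy_pos: "0 < p \<Longrightarrow> p \<le> 1 / 2 \<Longrightarrow> 0 < binary_entropy p"
  unfolding binary_entropy_def
  using mult_pos_neg[of p "log 2 p"] mult_pos_neg[of "1 - p" "log 2 (1 - p)"]
  by (simp add: log_less_zero_cancel_iff)

text \<open>At 0, where the logarithm is discontinuous, the comparison uses that the entropy is 0
  there and positive to the right.\<close>

lemma strict_mono_on_binary_entropy: "strict_mono_on {0..1 / 2} binary_entropy"
proof (rule strict_mono_onI)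
  fix p q :: real assume "p \<in> {0..1 / 2}" "q \<in> {0..1 / 2}" "p < q"
  then show "binary_entropy p < binary_entropy q"
    by (cases "p = 0") (auto intro: binary_entropy_strict_mono binary_entropy_pos)
qed

text \<open>At 0 the relevant filter is the right-hand one, along which p log p tends to 0, in
  accordance with 0 log 0 = 0.\<close>

lemma continuous_on_binary_entropy: "continuous_on {0..1 / 2} binary_entropy"
proof (rule continuous_on_eq_continuous_within[THEN iffD2], rule ballI)
  fix p :: real assume p: "p \<in> {0..1 / 2}"
  show "continuous (at p within {0..1 / 2}) binary_entropy"
  proof (cases "p = 0")
    case True
    have "(binary_entropy \<longlongrightarrow> 0) (at_right 0)"
      unfolding binary_entropy_def[abs_def] by real_asymp
    moreover have "at (0::real) within {0..1 / 2} = at_right 0"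
      by (rule at_within_Icc_at_right) simp
    ultimately show ?thesis using True by (simp add: continuous_within)
  next
    case False
    then have "isCont binary_entropy p"
      unfolding binary_entropy_def[abs_def] using p by (intro continuous_intros) auto
    then show ?thesis by (rule continuous_at_imp_continuous_at_within)
  qed
qed

lemma binary_entropy_image: "binary_entropy ` {0..1 / 2} = {0..1}"
proof (intro equalityI subsetI)
  fix y assume "y \<in> binary_entropy ` {0..1 / 2}"
  then obtain p where p: "p \<in> {0..1 / 2}" "y = binary_entropy p" by blast
  have mono: "mono_on {0..1 / 2} binary_entropy"
    by (rule strict_mono_on_imp_mono_on[OF strict_mono_on_binary_entropy])
  show "y \<in> {0..1}"
    using monotone_onD[OF mono, of 0 p] monotone_onD[OF mono, of p "1 / 2"] p by simp
next
  fix y :: real assume "y \<in> {0..1}"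
  then obtain p where "0 \<le> p" "p \<le> 1 / 2" "binary_entropy p = y"
    using IVT'[of binary_entropy 0 y "1 / 2"] continuous_on_binary_entropy by auto
  then show "y \<in> binary_entropy ` {0..1 / 2}" by auto
qed

lemma inv_binary_entropy:
  assumes "s \<in> {0..1}"
  shows "inv_binary_entropy s \<in> {0..1 / 2}" "binary_entropy (inv_binary_entropy s) = s"
  using the_inv_into_into[of binary_entropy "{0..1 / 2}" s "{0..1 / 2}"]
    f_the_inv_into_f[of binary_entropy "{0..1 / 2}" s]
    strict_mono_on_imp_inj_on[OF strict_mono_on_binary_entropy] assms
  by (auto simp: inv_binary_entropy_def binary_entropy_image)

lemma inv_binary_entropy_mono:
  assumes "0 \<le> s" "s \<le> t" "t \<le> 1"
  shows "inv_binary_entropy s \<le> inv_binary_entropy t"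
proof (rule ccontr)
  assume "\<not> inv_binary_entropy s \<le> inv_binary_entropy t"
  then have "binary_entropy (inv_binary_entropy t) < binary_entropy (inv_binary_entropy s)"
    using assms by (intro strict_mono_onD[OF strict_mono_on_binary_entropy] inv_binary_entropy) auto
  then show False using assms inv_binary_entropy by simp
qed

lemma inv_binary_entropy_pos:
  assumes "0 < s" "s \<le> 1" shows "0 < inv_binary_entropy s"
  using inv_binary_entropy[of s] assms by (cases "inv_binary_entropy s = 0") auto

theorem corollary6p3:
  fixes s_lo s_hi :: real and \<eta> :: "real measure"
  assumes "0 < s_lo" and "s_lo < s_hi" and "s_hi \<le> 1"
    and "prob_space \<eta>" and "sets \<eta> = sets borel" and "emeasure \<eta> {s_lo..s_hi} = 1"
  shows "prob_space (digit_mixture \<eta>) \<and> emeasure (digit_mixture \<eta>) {0..1} = 1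
    \<and> (\<forall>x. emeasure (digit_mixture \<eta>) {x} = 0)
    \<and> measure_support (digit_mixture \<eta>) = {0..1}
    \<and> (\<forall>n. \<forall>Q\<in>dyadic_partition n.
          measure (digit_mixture \<eta>) Q \<le> (1 - inv_binary_entropy s_lo) ^ n)
    \<and> (AE x in digit_mixture \<eta>. convergent (local_dim_seq (digit_mixture \<eta>) x))
    \<and> local_dim (digit_mixture \<eta>) \<in> borel_measurable (digit_mixture \<eta>)
    \<and> distr (digit_mixture \<eta>) borel (local_dim (digit_mixture \<eta>)) = \<eta>
    \<and> has_entropy_dim (digit_mixture \<eta>) (LINT s:{s_lo..s_hi}|\<eta>. s)
    \<and> has_quant_dim0 (digit_mixture \<eta>) (inverse (LINT s:{s_lo..s_hi}|\<eta>. inverse s))"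
proof -
  interpret eta: prob_space \<eta> by fact
  note [measurable_cong] = \<open>sets \<eta> = sets borel\<close>
  \<comment> \<open>Clamping to \<open>{s_lo..s_hi}\<close> changes the parameter on a null set only and makes it globally monotone, hence Borel.\<close>
  define cl where "cl s = max s_lo (min s_hi s)" for s
  define p where "p s = inv_binary_entropy (cl s)" for s
  define \<pi> where "\<pi> = distr \<eta> borel p"
  have cl: "s_lo \<le> cl s" "cl s \<le> s_hi" "0 \<le> cl s" "cl s \<le> 1" "cl s \<in> {0..1}" for s
    using assms by (auto simp: cl_def)
  have "mono p"
    using cl by (intro monoI) (auto simp: p_def cl_def intro!: inv_binary_entropy_mono)
  then have p_borel: "p \<in> borel_measurable borel" by (rule borel_measurable_mono)
  then have p_meas [measurable]: "p \<in> borel_measurable \<eta>" by simp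
  have p_bounds: "p s \<in> {inv_binary_entropy s_lo..1 / 2}" for s
    using inv_binary_entropy_mono[of s_lo "cl s"] inv_binary_entropy(1)[OF cl(5)[of s]] assms cl[of s]
    by (auto simp: p_def)
  have h_p: "binary_entropy (p s) = cl s" for s
    unfolding p_def by (rule inv_binary_entropy(2)[OF cl(5)])
  have AE_eta: "AE s in \<eta>. s \<in> {s_lo..s_hi}"
    using assms by (intro eta.AE_in_set_eq_1[THEN iffD2]) (auto simp: eta.emeasure_eq_measure)
  have AE_cl: "AE s in \<eta>. cl s = s"
    using AE_eta by eventually_elim (auto simp: cl_def)
  \<comment> \<open>Taking c as the inverse entropy of \<open>s_lo\<close> gives the base 1 - c of
    the claimed cell bound.\<close>
  interpret digit_mixture_law \<pi> "inv_binary_entropy s_lo"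
  proof (intro digit_mixture_law.intro digit_mixture_law_axioms.intro)
    show "prob_space \<pi>" unfolding \<pi>_def by (rule eta.prob_space_distr[OF p_meas])
    show "AE q in \<pi>. q \<in> {inv_binary_entropy s_lo..1 / 2}"
      unfolding \<pi>_def by (subst AE_distr_iff) (use p_bounds in auto)
    show "inv_binary_entropy s_lo \<le> 1 / 2" using inv_binary_entropy(1)[of s_lo] assms by auto
  qed (use assms inv_binary_entropy_pos in \<open>auto simp: \<pi>_def\<close>)
  \<comment> \<open>The defining set function agrees with \<open>emeasure mix\<close> on the Borel
    sets. It is thereby countably additive, and \<open>measure_of\<close> returns the mixture itself
    instead of the null measure.\<close>
  have mix: "digit_mixture \<eta> = mix"
  proof -
    have "(\<integral>\<^sup>+s. emeasure (digit_law (inv_binary_entropy s)) E \<partial>\<eta>) = emeasure mix E"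
      if E: "E \<in> sigma_sets UNIV (sets borel)" for E
    proof -
      have Es [measurable]: "E \<in> sets borel" using E by (metis sets.sigma_sets_eq space_borel)
      have [measurable]: "(\<lambda>q. emeasure (digit_law q) E) \<in> borel_measurable borel"
        using measurable_compose[OF measurable_prob_algebraD[OF digit_law_kernel] measurable_emeasure_subprob_algebra] by simp
      have "emeasure mix E = (\<integral>\<^sup>+q. emeasure (digit_law q) E \<partial>\<pi>)" by (rule emeasure_mix[OF Es])
      also have "\<dots> = (\<integral>\<^sup>+s. emeasure (digit_law (p s)) E \<partial>\<eta>)"
        unfolding \<pi>_def by (subst nn_integral_distr) auto
      also have "\<dots> = (\<integral>\<^sup>+s. emeasure (digit_law (inv_binary_entropy s)) E \<partial>\<eta>)"
      proof (rule nn_integral_cong_AE)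
        show "AE s in \<eta>. emeasure (digit_law (p s)) E = emeasure (digit_law (inv_binary_entropy s)) E"
          using AE_cl by eventually_elim (simp add: p_def)
      qed
      finally show ?thesis by simp
    qed
    then have "digit_mixture \<eta> = measure_of UNIV (sets borel) (emeasure mix)"
      unfolding digit_mixture_def by (intro measure_of_eq) auto
    also have "\<dots> = mix"
      using measure_of_of_measure[of mix] sets_mix sets_eq_imp_space_eq[OF sets_mix] by simp
    finally show ?thesis .
  qed
  \<comment> \<open>Entropy undoes its inverse, leaving the clamping map, which is the identity
    \<eta>-almost everywhere.\<close>
  have law: "distr \<pi> borel binary_entropy = \<eta>"
  proof -
    have "distr \<pi> borel binary_entropy = distr \<eta> borel (\<lambda>s. cl s)"
      unfolding \<pi>_def by (subst distr_distr) (auto simp: comp_def h_p)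
    also have "\<dots> = distr \<eta> borel (\<lambda>s. s)"
      using AE_cl by (intro distr_cong_AE) (auto simp: cl_def)
    also have "\<dots> = \<eta>" by (rule distr_id2) (simp add: assms(5))
    finally show ?thesis .
  qed
  have integral: "(\<integral>q. g (binary_entropy q) \<partial>\<pi>) = (LINT s:{s_lo..s_hi}|\<eta>. g s)"
    if [measurable]: "g \<in> borel_measurable borel" for g :: "real \<Rightarrow> real"
  proof -
    have "(\<integral>q. g (binary_entropy q) \<partial>\<pi>) = (\<integral>s. g s \<partial>distr \<pi> borel binary_entropy)"
      by (subst integral_distr) auto
    also have "\<dots> = (LINT s:{s_lo..s_hi}|\<eta>. g s)"
      unfolding law set_lebesgue_integral_def
    proof (rule integral_cong_AE)
      show "AE s in \<eta>. g s = indicator {s_lo..s_hi} s *\<^sub>R g s"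
        using AE_eta by eventually_elim simp
    qed auto
    finally show ?thesis .
  qed
  show ?thesis
    unfolding mix
    using prob_space_mix mix_unit measure_support_mix measure_mix_cell_bounds(2) regular.AE_convergent
      has_entropy_dim_mix has_quant_dim0_mix integral[of "\<lambda>s. s"] integral[of inverse]
    by (auto simp: regular.emeasure_eq_measure regular.measure_singleton distr_local_dim_mix law)
qed

end
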